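(* Let $\mathbf s=(s_1,\dots,s_N)$ be a symmetric parity sequence with $N\ge3$. In the extended twisted super Yangian $\mathscr X^{\mathbf s}$ put $$\mathcal T_{ij}(u)=x_{11}(u+s_1)x_{ij}(u)-x_{i1}(u+s_1)x_{1j}(u),\qquad 2\le i,j\le N-1 .$$ Then the map $x_{ij}(u)\mapsto\mathcal T_{ij}(u)$, $2\le i,j\le N-1$, defines a superalgebra homomorphism $\mathscr X^{\mathbf s}_{[2,2']}\to\mathscr X^{\mathbf s}$, where $\mathscr X^{\mathbf s}_{[2,2']}$ is the extended twisted super Yangian associated with the symmetric parity sequence $(s_2,\dots,s_{N-1})$, its generators being labelled by the indices $2\le i,j\le N-1$.
   Context: Everything is over $\mathbb C$. A parity sequence is $\mathbf s=(s_1,\dots,s_N)$ with $s_i\in\{\pm1\}$; put $i'=N+1-i$; $\mathbf s$ is symmetric if $s_i=s_{i'}$ for all $i$. Define $|i|\in\mathbb Z/2$ by $s_i=(-1)^{|i|}$; $[x,y]=xy-(-1)^{|x||y|}yx$. The extended twisted super Yangian $\mathscr X^{\mathbf s}$ is the unital superalgebra with generators $x_{ij}^{(r)}$ ($1\le i,j\le N$, $r\ge1$) of parity $|i|+|j|$ and, with $x_{ij}(u)=\delta_{ij}+\sum_{r\ge1}x_{ij}^{(r)}u^{-r}$, relations $$[x_{ij}(u),x_{kl}(v)]=\tfrac{\varepsilon}{u-v}\big(x_{kj}(u)x_{il}(v)-x_{kj}(v)x_{il}(u)\big)+\tfrac{\varepsilon}{u+v}\Big(\delta_{kj'}\sum_{a}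 x_{ia'}(u)x_{al}(v)-\delta_{il'}\sum_{a} x_{ka'}(v)x_{aj}(u)\Big)-\tfrac{\delta_{ij'}}{u^2-v^2}\Big(\sum_{a} x_{ka'}(u)x_{al}(v)-\sum_{a} x_{ka'}(v)x_{al}(u)\Big),$$ where $\varepsilon=(-1)^{|i||j|+|i||k|+|j||k|}$ and $a$ runs over $1,\dots,N$. For $\mathscr X^{\mathbf s}_{[2,2']}$ (with $2'=N-1$), the same formulas are used with all indices, including $a$, running over $2,\dots,N-1$ and with $i'=N+1-i$. *)

theory Defs
  imports
    "HOL-Algebra.QuotRing"
    "HOL-Algebra.Module"
    "HOL-Library.Poly_Mapping"
    "HOL-Library.Z2"
    "HOL-Computational_Algebra.Formal_Power_Series"
begin

section \<open>Superalgebras over the complex numbers\<close>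

record 'a superalgebra = "(complex, 'a) module" +
  grade :: "bit \<Rightarrow> 'a set"

definition superalg_hom ::
    "('a, 'm) superalgebra_scheme \<Rightarrow> ('b, 'n) superalgebra_scheme \<Rightarrow> ('a \<Rightarrow> 'b) set" where
  "superalg_hom A B = {h \<in> ring_hom A B.
     (\<forall>c. \<forall>x \<in> carrier A. h (c \<odot>\<^bsub>A\<^esub> x) = c \<odot>\<^bsub>B\<^esub> h x) \<and>
     (\<forall>p. \<forall>x \<in> grade A p. h x \<in> grade B p)}"

text \<open>The quotient by a two-sided ideal \<open>I\<close> that is stable under scalars and homogeneous.\<close>

definition quot_superalg ::
    "('a, 'm) superalgebra_scheme \<Rightarrow> 'a set \<Rightarrow> 'a set superalgebra" where
  "quot_superalg A I =
     \<lparr>carrier = carrier (A Quot I), monoid.mult = monoid.mult (A Quot I), one = one (A Quot I),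
      zero = zero (A Quot I), add = add (A Quot I),
      smult = (\<lambda>c X. \<Union>x \<in> X. I +>\<^bsub>A\<^esub> (c \<odot>\<^bsub>A\<^esub> x)),
      grade = (\<lambda>p. (\<lambda>x. I +>\<^bsub>A\<^esub> x) ` grade A p)\<rparr>"

text \<open>Words under concatenation are the free monoid, so that \<open>'g list \<Rightarrow>\<^sub>0 complex\<close>, with the
  convolution product of \<^theory>\<open>HOL-Library.Poly_Mapping\<close>, is the free associative algebra.\<close>

instantiation list :: (type) monoid_add
begin

definition zero_list :: "'a list" where "zero_list = []"

definition plus_list :: "'a list \<Rightarrow> 'a list \<Rightarrow> 'a list" where "plus_list = append"

instance
  by standard (simp_all add: zero_list_def plus_list_def)

end

definition free_superalg :: "'g set \<Rightarrow> ('g \<Rightarrow> bit) \<Rightarrow> ('g list \<Rightarrow>\<^sub>0 complex) superalgebra" where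
  "free_superalg G d =
     \<lparr>carrier = {f. \<forall>w \<in> Poly_Mapping.keys f. set w \<subseteq> G},
      monoid.mult = (*), one = 1, zero = 0, add = (+),
      smult = (\<lambda>c. Poly_Mapping.map ((*) c)),
      grade = (\<lambda>p. {f. \<forall>w \<in> Poly_Mapping.keys f. set w \<subseteq> G \<and> sum_list (map d w) = p})\<rparr>"

lemma ring_free_superalg: "ring (free_superalg G d)" (is "ring ?R")
proof -
  have mem: "f \<in> carrier ?R \<longleftrightarrow> (\<forall>w \<in> Poly_Mapping.keys f. set w \<subseteq> G)"
    and ops: "\<And>f g. f \<otimes>\<^bsub>?R\<^esub> g = f * g" "\<And>f g. f \<oplus>\<^bsub>?R\<^esub> g = f + g"
      "\<one>\<^bsub>?R\<^esub> = 1" "\<zero>\<^bsub>?R\<^esub> = 0" for f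
    by (simp_all add: free_superalg_def)
  have one: "1 \<in> carrier ?R" and zero: "0 \<in> carrier ?R"
    unfolding mem by (simp_all add: zero_list_def)
  have neg: "- f \<in> carrier ?R" if "f \<in> carrier ?R" for f
    using that unfolding mem by simp
  have add: "f + g \<in> carrier ?R" if "f \<in> carrier ?R" "g \<in> carrier ?R" for f g
    using that Poly_Mapping.keys_add[of f g] unfolding mem by blast
  have mult: "f * g \<in> carrier ?R" if "f \<in> carrier ?R" "g \<in> carrier ?R" for f g
    unfolding mem
  proof
    fix w assume "w \<in> Poly_Mapping.keys (f * g)"
    then obtain a b where "w = a + b" "a \<in> Poly_Mapping.keys f" "b \<in> Poly_Mapping.keys g"
      using keys_mult[of f g] by blast
    with that show "set w \<subseteq> G"
      unfolding mem plus_list_def by simp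
  qed
  show ?thesis
  proof (rule ringI)
    show "abelian_group ?R"
    proof (rule abelian_groupI)
      fix x assume "x \<in> carrier ?R"
      then show "\<exists>y\<in>carrier ?R. y \<oplus>\<^bsub>?R\<^esub> x = \<zero>\<^bsub>?R\<^esub>"
        by (intro bexI[of _ "- x"] neg) (simp_all only: ops left_minus)
    qed (simp_all only: ops add zero ac_simps add_0_left add_0_right)
    show "Group.monoid ?R"
      by (rule monoidI) (simp_all only: ops one mult mult.assoc mult_1_left mult_1_right)
  qed (simp_all only: ops distrib_left distrib_right)
qed

section \<open>Parity sequences\<close>

definition parity_sequence :: "nat \<Rightarrow> (nat \<Rightarrow> int) \<Rightarrow> bool" where
  "parity_sequence N s \<longleftrightarrow> (\<forall>i \<in> {1..N}. s i = 1 \<or> s i = -1)"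

definition symmetric_sequence :: "nat \<Rightarrow> (nat \<Rightarrow> int) \<Rightarrow> bool" where
  "symmetric_sequence N s \<longleftrightarrow> (\<forall>i \<in> {1..N}. s i = s (N + 1 - i))"

definition parity :: "(nat \<Rightarrow> int) \<Rightarrow> nat \<Rightarrow> bit" where
  "parity s i = (if s i = 1 then 0 else 1)"

definition sgn_bit :: "bit \<Rightarrow> 'a::ring_1" where
  "sgn_bit b = (if b = 0 then 1 else -1)"

section \<open>Extended twisted super Yangians\<close>

text \<open>The algebra is defined for an arbitrary interval of indices \<open>{m..n}\<close>, with
  \<open>i' = m + n - i\<close>: \<open>{1..N}\<close> and \<open>{2..N - 1}\<close> both give \<open>i' = N + 1 - i\<close>.
  The triple \<open>(i, j, r)\<close> with \<open>r \<ge> 1\<close> stands for the generator \<open>x\<^sub>i\<^sub>j\<^sup>(\<^sup>r\<^sup>)\<close>.\<close>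

type_synonym gen = "nat \<times> nat \<times> nat"

type_synonym free_alg = "gen list \<Rightarrow>\<^sub>0 complex"

definition gens :: "nat \<Rightarrow> nat \<Rightarrow> gen set" where
  "gens m n = {m..n} \<times> {m..n} \<times> {1..}"

definition gen_parity :: "(nat \<Rightarrow> int) \<Rightarrow> gen \<Rightarrow> bit" where
  "gen_parity s = (\<lambda>(i, j, r). parity s i + parity s j)"

definition free_yangian :: "(nat \<Rightarrow> int) \<Rightarrow> nat \<Rightarrow> nat \<Rightarrow> free_alg superalgebra" where
  "free_yangian s m n = free_superalg (gens m n) (gen_parity s)"

text \<open>The series \<open>x\<^sub>i\<^sub>j(u)\<close>, lifted to the free algebra, as a power series in \<open>u\<^sup>-\<^sup>1\<close>.\<close>

definition x_ser :: "nat \<Rightarrow> nat \<Rightarrow> free_alg fps" where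
  "x_ser i j = Abs_fps (\<lambda>r. if r = 0 then (if i = j then 1 else 0)
                             else Poly_Mapping.single [(i, j, r)] 1)"

text \<open>Series in \<open>u\<^sup>-\<^sup>1\<close> and \<open>v\<^sup>-\<^sup>1\<close> are power series in \<open>v\<^sup>-\<^sup>1\<close> over the power series in \<open>u\<^sup>-\<^sup>1\<close>.\<close>

definition in_u :: "'a::ring_1 fps \<Rightarrow> 'a fps fps" where
  "in_u f = fps_const f"

definition in_v :: "'a::ring_1 fps \<Rightarrow> 'a fps fps" where
  "in_v f = Abs_fps (\<lambda>k. fps_const (fps_nth f k))"

text \<open>The difference of the two sides of the defining relation, multiplied by \<open>u\<^sup>2 - v\<^sup>2\<close> to clear
  the denominators and then by \<open>p\<^sup>2 q\<^sup>2\<close>, where \<open>p = u\<^sup>-\<^sup>1\<close> and \<open>q = v\<^sup>-\<^sup>1\<close>, to remove the positive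
  powers of \<open>u\<close> and \<open>v\<close>.  The factors \<open>1\<close>, \<open>1/(u - v)\<close>, \<open>1/(u + v)\<close>, \<open>1/(u\<^sup>2 - v\<^sup>2)\<close> thus become
  \<open>q\<^sup>2 - p\<^sup>2\<close>, \<open>p q (p + q)\<close>, \<open>p q (q - p)\<close>, \<open>p\<^sup>2 q\<^sup>2\<close>.\<close>

definition relator ::
    "(nat \<Rightarrow> int) \<Rightarrow> nat \<Rightarrow> nat \<Rightarrow> nat \<Rightarrow> nat \<Rightarrow> nat \<Rightarrow> nat \<Rightarrow> free_alg fps fps" where
  "relator s m n i j k l =
    (let p = in_u fps_X; q = in_v fps_X;
         xu = (\<lambda>i j. in_u (x_ser i j)); xv = (\<lambda>i j. in_v (x_ser i j));
         pr = (\<lambda>i. m + n - i);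
         \<delta> = (\<lambda>i j. if i = j then 1 else 0);
         \<epsilon> = sgn_bit (parity s i * parity s j + parity s i * parity s k + parity s j * parity s k);
         \<sigma> = sgn_bit ((parity s i + parity s j) * (parity s k + parity s l))
     in (q^2 - p^2) * (xu i j * xv k l - \<sigma> * (xv k l * xu i j))
        - \<epsilon> * (p * q * (p + q)) * (xu k j * xv i l - xv k j * xu i l)
        - \<epsilon> * (p * q * (q - p)) * (\<delta> k (pr j) * (\<Sum>a \<in> {m..n}. xu i (pr a) * xv a l)
                                   - \<delta> i (pr l) * (\<Sum>a \<in> {m..n}. xv k (pr a) * xu a j))
        + \<delta> i (pr j) * (p^2 * q^2) * ((\<Sum>a \<in> {m..n}. xu k (pr a) * xv a l)
                                      - (\<Sum>a \<in> {m..n}. xv k (pr a) * xu a l)))"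

definition relators :: "(nat \<Rightarrow> int) \<Rightarrow> nat \<Rightarrow> nat \<Rightarrow> free_alg set" where
  "relators s m n = {fps_nth (fps_nth (relator s m n i j k l) b) a | i j k l a b.
     i \<in> {m..n} \<and> j \<in> {m..n} \<and> k \<in> {m..n} \<and> l \<in> {m..n}}"

definition yangian_ideal :: "(nat \<Rightarrow> int) \<Rightarrow> nat \<Rightarrow> nat \<Rightarrow> free_alg set" where
  "yangian_ideal s m n = genideal (free_yangian s m n) (relators s m n)"

definition ext_twisted_super_yangian ::
    "(nat \<Rightarrow> int) \<Rightarrow> nat \<Rightarrow> nat \<Rightarrow> free_alg set superalgebra" where
  "ext_twisted_super_yangian s m n = quot_superalg (free_yangian s m n) (yangian_ideal s m n)"

definition yangian_class :: "(nat \<Rightarrow> int) \<Rightarrow> nat \<Rightarrow> nat \<Rightarrow> free_alg \<Rightarrow> free_alg set" where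
  "yangian_class s m n f = yangian_ideal s m n +>\<^bsub>free_yangian s m n\<^esub> f"

text \<open>\<open>f(u + c)\<close> for a power series \<open>f\<close> in \<open>u\<^sup>-\<^sup>1\<close>, where
  \<open>(u + c)\<^sup>-\<^sup>1 = u\<^sup>-\<^sup>1 - c u\<^sup>-\<^sup>2 + c\<^sup>2 u\<^sup>-\<^sup>3 - \<dots>\<close>.\<close>

definition shift_ser :: "int \<Rightarrow> 'a::ring_1 fps \<Rightarrow> 'a fps" where
  "shift_ser c f = f oo Abs_fps (\<lambda>r. if r = 0 then 0 else of_int ((- c) ^ (r - 1)))"

text \<open>The series \<open>\<T>\<^sub>i\<^sub>j(u)\<close>, lifted to the free algebra.\<close>

definition T_ser :: "(nat \<Rightarrow> int) \<Rightarrow> nat \<Rightarrow> nat \<Rightarrow> free_alg fps" where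
  "T_ser s i j = shift_ser (s 1) (x_ser 1 1) * x_ser i j - shift_ser (s 1) (x_ser i 1) * x_ser 1 j"

end

theory Submission
  imports Defs
begin

text \<open>
  Write \<open>a = x\<^sub>1\<^sub>1\<close> and let \<open>y\<^sub>i\<^sub>j(u) = x\<^sub>i\<^sub>j(u) - x\<^sub>i\<^sub>1(u) a(u)\<^sup>-\<^sup>1 x\<^sub>1\<^sub>j(u)\<close> be the Schur complement of the
  corner entry; \<open>a\<close> is invertible because its constant term is \<open>1\<close>.  The theorem rests on four facts
  about \<open>2 \<le> i, j, k, l \<le> N - 1\<close>.

  (1) \<open>a(u)\<close> commutes with \<open>y\<^sub>k\<^sub>l(v)\<close> (\<open>corner_commutes_mem\<close>).

  (2) The \<open>y\<^sub>i\<^sub>j(u)\<close> satisfy the defining relations for the index range \<open>{2..N - 1}\<close>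
  (\<open>schur_defect_mem\<close>).

  (3) \<open>\<T>\<^sub>i\<^sub>j(u) = a(u + s\<^sub>1) y\<^sub>i\<^sub>j(u)\<close> (\<open>T_cong_Y\<close>), because the relation between \<open>a(u)\<close> and \<open>x\<^sub>i\<^sub>1(v)\<close>,
  specialised at \<open>u = v + s\<^sub>1\<close>, becomes \<open>x\<^sub>i\<^sub>1(v + s\<^sub>1) a(v) = a(v + s\<^sub>1) x\<^sub>i\<^sub>1(v)\<close> (\<open>column_shift\<close>).

  (4) Every term of a defining relation contains one generating series in \<open>u\<close> and one in \<open>v\<close>.
  By (1), and because the coefficients of \<open>a\<close> commute, replacing \<open>y\<^sub>i\<^sub>j(u)\<close> by \<open>a(u + s\<^sub>1) y\<^sub>i\<^sub>j(u)\<close> therefore multiplies the whole relation by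
  \<open>a(u + s\<^sub>1) a(v + s\<^sub>1)\<close>, so that the relations for \<open>y\<close> give those for \<open>\<T>\<close> (\<open>T_relation\<close>).

  For (1) and (2) the key is an intermediate formula (\<open>mixed_defect_mem\<close>) for the supercommutator of
  an entry \<open>x\<^sub>i\<^sub>j(u)\<close>, \<open>i, j \<noteq> N\<close>, with \<open>y\<^sub>k\<^sub>l(v)\<close>.  It is obtained by expanding \<open>y\<^sub>k\<^sub>l(v)\<close> and applying
  the defining relations to the four entries of \<open>x(v)\<close> in rows \<open>k, 1\<close> and columns \<open>l, 1\<close>;
  no two factors have to be interchanged, so that it is a linear combination of four defining
  relations with coefficients on the outside.  The sum over \<open>a\<close> in the relations reduces to the
  sum over the smaller range by itself: \<open>y\<^sub>1\<^sub>l = 0 = y\<^sub>k\<^sub>1\<close>, and in \<open>\<Sum>\<^sub>a y\<^sub>i\<^sub>a\<^sub>'(u) y\<^sub>a\<^sub>l(v)\<close> the index \<open>a = 1\<close> kills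
  the second factor while \<open>a = N\<close>, \<open>a' = 1\<close>, kills the first.  Fact (1) is the case \<open>i = j = 1\<close>.
  For (2) the same expansion is carried out in the first argument.  Some terms
  remain; they are again supercommutators of the intermediate kind, and after inserting the formula
  a second time those with \<open>1/(u - v)\<^sup>2\<close> cancel by (1), and those with
  \<open>1/((u - v)(u + v))\<close> cancel against the last term of the defining relation.

  Equality in the quotient algebra is expressed as membership of coefficients in an ideal, which
  makes all of these computations identities in a noncommutative ring with unit.
\<close>

section \<open>Two-sided ideals\<close>

locale two_sided_ideal =
  fixes J :: "'a::ring_1 set"
  assumes zero_mem: "0 \<in> J"
    and add_mem: "x \<in> J \<Longrightarrow> y \<in> J \<Longrightarrow> x + y \<in> J"
    and mult_left_mem: "x \<in> J \<Longrightarrow> r * x \<in> J"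
    and mult_right_mem: "x \<in> J \<Longrightarrow> x * r \<in> J"
begin

lemma uminus_mem: "x \<in> J \<Longrightarrow> - x \<in> J"
  using mult_left_mem[of x "- 1"] by simp

lemma diff_mem: "x \<in> J \<Longrightarrow> y \<in> J \<Longrightarrow> x - y \<in> J"
  using add_mem[of x "- y"] uminus_mem[of y] by simp

lemma sum_mem: "(\<And>a. a \<in> A \<Longrightarrow> f a \<in> J) \<Longrightarrow> sum f A \<in> J"
  by (induction A rule: infinite_finite_induct) (auto intro: zero_mem add_mem)

lemmas mem_intros = add_mem diff_mem uminus_mem mult_left_mem mult_right_mem sum_mem zero_mem

definition cong :: "'a \<Rightarrow> 'a \<Rightarrow> bool"  (infix \<open>\<approx>\<close> 50)
  where "x \<approx> y \<longleftrightarrow> x - y \<in> J"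

lemma cong_refl: "x \<approx> x"
  by (simp add: cong_def zero_mem)

lemma cong_trans [trans]: "x \<approx> y \<Longrightarrow> y \<approx> z \<Longrightarrow> x \<approx> z"
  using add_mem[of "x - y" "y - z"] by (simp add: cong_def)

lemma cong_add: "x \<approx> y \<Longrightarrow> x' \<approx> y' \<Longrightarrow> x + x' \<approx> y + y'"
  using add_mem[of "x - y" "x' - y'"] by (simp add: cong_def algebra_simps)

lemma cong_diff: "x \<approx> y \<Longrightarrow> x' \<approx> y' \<Longrightarrow> x - x' \<approx> y - y'"
  using diff_mem[of "x - y" "x' - y'"] by (simp add: cong_def algebra_simps)

lemma cong_mult: "x \<approx> y \<Longrightarrow> x' \<approx> y' \<Longrightarrow> x * x' \<approx> y * y'"
  using add_mem[OF mult_right_mem[of "x - y" x'] mult_left_mem[of "x' - y'" y]]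
  by (simp add: cong_def algebra_simps)

lemma cong_sum: "(\<And>a. a \<in> A \<Longrightarrow> f a \<approx> g a) \<Longrightarrow> sum f A \<approx> sum g A"
  unfolding cong_def sum_subtractf[symmetric] by (rule sum_mem)

lemma cong_mem: "x \<approx> y \<Longrightarrow> y \<in> J \<Longrightarrow> x \<in> J"
  using add_mem[of "x - y" y] by (simp add: cong_def)

end

section \<open>The defining relation as a bilinear expression\<close>

text \<open>The two signs of the defining relation: \<open>\<epsilon>\<close>, and the sign of the supercommutator
  of entries \<open>(i, j)\<close> and \<open>(k, l)\<close>.\<close>
definition eps_sign :: "(nat \<Rightarrow> bit) \<Rightarrow> nat \<Rightarrow> nat \<Rightarrow> nat \<Rightarrow> 'a::ring_1" where
  "eps_sign \<pi> i j k = sgn_bit (\<pi> i * \<pi> j + \<pi> i * \<pi> k + \<pi> j * \<pi> k)"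

definition sigma_sign :: "(nat \<Rightarrow> bit) \<Rightarrow> nat \<Rightarrow> nat \<Rightarrow> nat \<Rightarrow> nat \<Rightarrow> 'a::ring_1" where
  "sigma_sign \<pi> i j k l = sgn_bit ((\<pi> i + \<pi> j) * (\<pi> k + \<pi> l))"

text \<open>The difference of the two sides of the defining relation is linear in the products
  \<open>x\<^sub>i\<^sub>j(u) x\<^sub>k\<^sub>l(v)\<close> and \<open>x\<^sub>k\<^sub>l(v) x\<^sub>i\<^sub>j(u)\<close>, which are the arguments \<open>P i j k l\<close> and \<open>Q k l i j\<close>.  Keeping the
  products as parameters allows both to be multiplied by a common factor.  The scalars
  \<open>\<alpha>\<close>, \<open>\<beta>\<close>, \<open>\<gamma>\<close>, \<open>\<kappa>\<close> stand for \<open>1\<close>, \<open>1/(u - v)\<close>, \<open>1/(u + v)\<close>, \<open>1/(u\<^sup>2 - v\<^sup>2)\<close> times a common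
  denominator.\<close>
definition exchange_defect ::
    "(nat \<Rightarrow> bit) \<Rightarrow> nat \<Rightarrow> nat \<Rightarrow> 'a::ring_1 \<Rightarrow> 'a \<Rightarrow> 'a \<Rightarrow> 'a \<Rightarrow> (nat \<Rightarrow> nat \<Rightarrow> nat \<Rightarrow> nat \<Rightarrow> 'a) \<Rightarrow>
      (nat \<Rightarrow> nat \<Rightarrow> nat \<Rightarrow> nat \<Rightarrow> 'a) \<Rightarrow> nat \<Rightarrow> nat \<Rightarrow> nat \<Rightarrow> nat \<Rightarrow> 'a" where
  "exchange_defect \<pi> m n \<alpha> \<beta> \<gamma> \<kappa> P Q i j k l =
     \<alpha> * (P i j k l - sigma_sign \<pi> i j k l * Q k l i j)
     - \<beta> * (eps_sign \<pi> i j k * (P k j i l - Q k j i l))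
     - \<gamma> * (eps_sign \<pi> i j k * (of_bool (k = m + n - j) * (\<Sum>a \<in> {m..n}. P i (m + n - a) a l)
                           - of_bool (i = m + n - l) * (\<Sum>a \<in> {m..n}. Q k (m + n - a) a j)))
     + \<kappa> * (of_bool (i = m + n - j) * ((\<Sum>a \<in> {m..n}. P k (m + n - a) a l)
                                        - (\<Sum>a \<in> {m..n}. Q k (m + n - a) a l)))"

lemma sgn_bit_cases: "sgn_bit b = (1::'a::ring_1) \<or> sgn_bit b = (- 1::'a)"
  by (simp add: sgn_bit_def)

lemma sgn_bit_add: "sgn_bit (b + c) = sgn_bit b * (sgn_bit c::'a::ring_1)"
  by (cases b; cases c) (simp_all add: sgn_bit_def)

lemma eps_sign_cases: "eps_sign \<pi> i j k = (1::'a::ring_1) \<or> eps_sign \<pi> i j k = (- 1::'a)"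
  unfolding eps_sign_def by (rule sgn_bit_cases)

lemma sigma_sign_cases: "sigma_sign \<pi> i j k l = (1::'a::ring_1) \<or> sigma_sign \<pi> i j k l = (- 1::'a)"
  unfolding sigma_sign_def by (rule sgn_bit_cases)

section \<open>The Schur complement of the corner entry\<close>

text \<open>\<open>U i j\<close> and \<open>V i j\<close> stand for \<open>x\<^sub>i\<^sub>j(u)\<close> and \<open>x\<^sub>i\<^sub>j(v)\<close>, and \<open>au\<close> and \<open>av\<close> for the inverses of the corner
  entries.  The condition \<open>\<beta> * \<gamma> = \<kappa> * \<alpha>\<close> encodes that the coefficient of the last term of the
  relation is the product of \<open>1/(u - v)\<close> and \<open>1/(u + v)\<close>.\<close>
locale schur_complement = two_sided_ideal J for J :: "'a::ring_1 set" +
  fixes \<alpha> \<beta> \<gamma> \<kappa> :: 'a and \<pi> :: "nat \<Rightarrow> bit" and N :: nat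
    and U V :: "nat \<Rightarrow> nat \<Rightarrow> 'a" and au av :: 'a
  assumes central: "\<alpha> * x = x * \<alpha>" "\<beta> * x = x * \<beta>" "\<gamma> * x = x * \<gamma>" "\<kappa> * x = x * \<kappa>"
    and coeffs: "\<beta> * \<gamma> = \<kappa> * \<alpha>"
    and cancel: "\<alpha> * x \<in> J \<Longrightarrow> x \<in> J"
    and N: "N \<ge> 3"
    and sym: "i \<in> {1..N} \<Longrightarrow> \<pi> (N + 1 - i) = \<pi> i"
    and inv_u: "U 1 1 * au = 1" "au * U 1 1 = 1"
    and inv_v: "V 1 1 * av = 1" "av * V 1 1 = 1"
    and rel: "i \<in> {1..N} \<Longrightarrow> j \<in> {1..N} \<Longrightarrow> k \<in> {1..N} \<Longrightarrow> l \<in> {1..N} \<Longrightarrow>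
      exchange_defect \<pi> 1 N \<alpha> \<beta> \<gamma> \<kappa> (\<lambda>i j k l. U i j * V k l) (\<lambda>k l i j. V k l * U i j) i j k l \<in> J"
begin

definition "Fu k = U k 1 * au"
definition "Fv k = V k 1 * av"
definition "Eu l = au * U 1 l"
definition "Ev l = av * V 1 l"
definition "Yu k l = U k l - U k 1 * au * U 1 l"
definition "Yv k l = V k l - V k 1 * av * V 1 l"
text \<open>Rows and columns of \<open>x(u)\<close> reduced by the pivots of \<open>x(v)\<close>: with \<open>v\<close> set to \<open>u\<close>, both
  would be the Schur complement.\<close>
definition "Mr k j = U k j - Fv k * U 1 j"
definition "Mc i l = U i l - U i 1 * Ev l"

text \<open>What the defining relation of \<open>x\<^sub>i\<^sub>j(u)\<close> and \<open>x\<^sub>k\<^sub>l(v)\<close> turns into when the second entry is replaced by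
  \<open>y\<^sub>k\<^sub>l(v)\<close>: the factors in \<open>v\<close> become entries of \<open>y(v)\<close>, and a factor in \<open>u\<close> is reduced when it has
  taken over the row \<open>k\<close> or the column \<open>l\<close>.\<close>
definition "mixed_defect i j k l =
     \<alpha> * (U i j * Yv k l - sigma_sign \<pi> i j k l * (Yv k l * U i j))
     - \<beta> * (eps_sign \<pi> i j k * (Mr k j * Yv i l - Yv k j * Mc i l))
     - \<gamma> * (eps_sign \<pi> i j k * (of_bool (k = 1 + N - j) * (\<Sum>a \<in> {1..N}. U i (1 + N - a) * Yv a l)
                           - of_bool (i = 1 + N - l) * (\<Sum>a \<in> {1..N}. Yv k (1 + N - a) * U a j)))
     + \<kappa> * (of_bool (i = 1 + N - j) * ((\<Sum>a \<in> {1..N}. Mr k (1 + N - a) * Yv a l)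
                                        - (\<Sum>a \<in> {1..N}. Yv k (1 + N - a) * Mc a l)))"

lemma inv_simps:
  "U 1 1 * (au * x) = x" "au * (U 1 1 * x) = x" "V 1 1 * (av * x) = x" "av * (V 1 1 * x) = x"
  using inv_u inv_v by (simp_all flip: mult.assoc)

text \<open>As \<open>y\<^sub>k\<^sub>l = x\<^sub>k\<^sub>l - F\<^sub>k x\<^sub>1\<^sub>l = x\<^sub>k\<^sub>l - x\<^sub>k\<^sub>1 E\<^sub>l = x\<^sub>k\<^sub>l - x\<^sub>k\<^sub>1 E\<^sub>l - F\<^sub>k x\<^sub>1\<^sub>l + F\<^sub>k x\<^sub>1\<^sub>1 E\<^sub>l\<close>, the last form, which is
  the operator \<open>L\<close> below, expresses the mixed defect through the four defining relations of
  \<open>x\<^sub>i\<^sub>j(u)\<close> with \<open>x\<^sub>k\<^sub>l(v)\<close>, \<open>x\<^sub>k\<^sub>1(v)\<close>, \<open>x\<^sub>1\<^sub>l(v)\<close>, \<open>x\<^sub>1\<^sub>1(v)\<close>.  The sign \<open>t\<close> comes from moving \<open>F\<^sub>k\<close>, of parity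
  \<open>|k| + |1|\<close>, past \<open>x\<^sub>i\<^sub>j\<close>.  The bounds \<open>i, j < N\<close> ensure that neither \<open>i\<close> nor \<open>j\<close> is \<open>1'\<close>, so that the
  relations with an index \<open>1\<close> have no term of type \<open>\<delta>\<close> coming from this index.\<close>
lemma mixed_defect_mem:
  assumes i: "i \<in> {1..<N}" and j: "j \<in> {1..<N}" and k: "k \<in> {2..<N}" and l: "l \<in> {2..<N}"
  shows "mixed_defect i j k l \<in> J"
proof -
  define R where "R k l = exchange_defect \<pi> 1 N \<alpha> \<beta> \<gamma> \<kappa>
    (\<lambda>i j k l. U i j * V k l) (\<lambda>k l i j. V k l * U i j) i j k l" for k l
  define t where "t = (sigma_sign \<pi> i j k 1 :: 'a)"
  define e where "e = (eps_sign \<pi> i j k :: 'a)"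
  define \<sigma> where "\<sigma> = (sigma_sign \<pi> i j k l :: 'a)"
  have tc: "t = 1 \<or> t = -1" and ec: "e = 1 \<or> e = -1" and sc: "\<sigma> = 1 \<or> \<sigma> = -1"
    unfolding t_def e_def \<sigma>_def by (rule sigma_sign_cases eps_sign_cases)+
  have e1: "eps_sign \<pi> i j 1 = t * e"
    unfolding t_def e_def eps_sign_def sigma_sign_def sgn_bit_add[symmetric]
    by (rule arg_cong[of _ _ sgn_bit]) (cases "\<pi> i"; cases "\<pi> j"; cases "\<pi> k"; cases "\<pi> 1"; simp)
  have s1: "sigma_sign \<pi> i j 1 l = t * \<sigma>"
    unfolding t_def \<sigma>_def eps_sign_def sigma_sign_def sgn_bit_add[symmetric]
    by (rule arg_cong[of _ _ sgn_bit]) (cases "\<pi> i"; cases "\<pi> j"; cases "\<pi> k"; cases "\<pi> 1"; cases "\<pi> l"; simp)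
  have s2: "sigma_sign \<pi> i j 1 1 = (1::'a)"
    by (cases "\<pi> 1") (simp_all add: sigma_sign_def sgn_bit_def)
  have tD: "t * of_bool (i = 1 + N - j) = of_bool (i = 1 + N - j)"
  proof (cases "i = 1 + N - j")
    case True
    then have "\<pi> i = \<pi> j" using sym[of j] j by (simp add: add.commute)
    then show ?thesis by (cases "\<pi> j") (simp_all add: t_def sigma_sign_def sgn_bit_def)
  qed simp
  define A where "A k l = U i j * V k l - sigma_sign \<pi> i j k l * (V k l * U i j)" for k l
  define B where "B k l = U k j * V i l - V k j * U i l" for k l
  define Z1 where "Z1 l = (\<Sum>a \<in> {1..N}. U i (1 + N - a) * V a l)" for l
  define Z2 where "Z2 k = (\<Sum>a \<in> {1..N}. V k (1 + N - a) * U a j)" for k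
  define D1 where "D1 k l = (\<Sum>a \<in> {1..N}. U k (1 + N - a) * V a l)" for k l
  define D2 where "D2 k l = (\<Sum>a \<in> {1..N}. V k (1 + N - a) * U a l)" for k l
  define L where "L w x y z = w - x * Ev l - t * (Fv k * y) + t * (Fv k * (z * Ev l))" for w x y z :: 'a
  have L_central: "L (c * w) (c * x) (c * y) (c * z) = c * L w x y z" if "\<And>x. c * x = x * c" for c w x y z
  proof -
    have "x * (c * y) = c * (x * y)" for x y
      by (metis that mult.assoc)
    then show ?thesis using tc unfolding L_def by (auto simp: algebra_simps)
  qed
  have L_minus: "L (w - w') (x - x') (y - y') (z - z') = L w x y z - L w' x' y' z'"
    and L_plus: "L (w + w') (x + x') (y + y') (z + z') = L w x y z + L w' x' y' z'" for w w' x x' y y' z z'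
    unfolding L_def by (simp_all add: algebra_simps)
  have R: "R k' l' = \<alpha> * A k' l' - \<beta> * (eps_sign \<pi> i j k' * B k' l')
     - \<gamma> * (eps_sign \<pi> i j k' * (of_bool (k' = 1 + N - j) * Z1 l' - of_bool (i = 1 + N - l') * Z2 k'))
     + \<kappa> * (of_bool (i = 1 + N - j) * (D1 k' l' - D2 k' l'))" for k' l'
    unfolding R_def exchange_defect_def A_def B_def Z1_def Z2_def D1_def D2_def ..
  have A: "L (A k l) (A k 1) (A 1 l) (A 1 1) = U i j * Yv k l - \<sigma> * (Yv k l * U i j)"
    using tc sc unfolding L_def A_def s1 s2 t_def[symmetric] \<sigma>_def[symmetric]
    by (auto simp: Yv_def Fv_def Ev_def algebra_simps inv_simps inv_v simp del: One_nat_def)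
  have B: "L (e * B k l) (e * B k 1) (t * e * B 1 l) (t * e * B 1 1)
      = e * (Mr k j * Yv i l - Yv k j * Mc i l)"
    using tc ec unfolding L_def B_def
    by (auto simp: Yv_def Fv_def Ev_def Mr_def Mc_def algebra_simps inv_simps inv_v simp del: One_nat_def)
  have Z1: "(\<Sum>a \<in> {1..N}. U i (1 + N - a) * Yv a l) = Z1 l - Z1 1 * Ev l"
    unfolding Z1_def sum_distrib_right sum_subtractf[symmetric]
    by (simp add: Yv_def Ev_def algebra_simps)
  have Z2: "(\<Sum>a \<in> {1..N}. Yv k (1 + N - a) * U a j) = Z2 k - Fv k * Z2 1"
    unfolding Z2_def sum_distrib_left sum_subtractf[symmetric]
    by (simp add: Yv_def Fv_def algebra_simps)
  have C: "L (e * (of_bool (k = 1 + N - j) * Z1 l - of_bool (i = 1 + N - l) * Z2 k))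
        (e * (of_bool (k = 1 + N - j) * Z1 1 - of_bool (i = 1 + N - 1) * Z2 k))
        (t * e * (of_bool (1 = 1 + N - j) * Z1 l - of_bool (i = 1 + N - l) * Z2 1))
        (t * e * (of_bool (1 = 1 + N - j) * Z1 1 - of_bool (i = 1 + N - 1) * Z2 1))
      = e * (of_bool (k = 1 + N - j) * (Z1 l - Z1 1 * Ev l)
             - of_bool (i = 1 + N - l) * (Z2 k - Fv k * Z2 1))"
  proof -
    have "\<not> i = 1 + N - 1" "\<not> 1 = 1 + N - j" using i j by auto
    then show ?thesis using tc ec unfolding L_def
      by (auto simp: algebra_simps)
  qed
  have D1: "(\<Sum>a \<in> {1..N}. Mr k (1 + N - a) * Yv a l)
      = D1 k l - D1 k 1 * Ev l - Fv k * D1 1 l + Fv k * (D1 1 1 * Ev l)"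
    unfolding D1_def sum_distrib_left sum_distrib_right sum_subtractf[symmetric] sum.distrib[symmetric]
    by (simp add: Mr_def Yv_def Fv_def Ev_def algebra_simps)
  have D2: "(\<Sum>a \<in> {1..N}. Yv k (1 + N - a) * Mc a l)
      = D2 k l - D2 k 1 * Ev l - Fv k * D2 1 l + Fv k * (D2 1 1 * Ev l)"
    unfolding D2_def sum_distrib_left sum_distrib_right sum_subtractf[symmetric] sum.distrib[symmetric]
    by (simp add: Mc_def Yv_def Fv_def Ev_def algebra_simps)
  have D: "L (of_bool (i = 1 + N - j) * (D1 k l - D2 k l)) (of_bool (i = 1 + N - j) * (D1 k 1 - D2 k 1))
       (of_bool (i = 1 + N - j) * (D1 1 l - D2 1 l)) (of_bool (i = 1 + N - j) * (D1 1 1 - D2 1 1))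
     = of_bool (i = 1 + N - j) * ((\<Sum>a \<in> {1..N}. Mr k (1 + N - a) * Yv a l)
                             - (\<Sum>a \<in> {1..N}. Yv k (1 + N - a) * Mc a l))"
    unfolding L_def D1 D2 using tD by (cases "i = 1 + N - j") (simp_all add: algebra_simps)
  have "mixed_defect i j k l = L (R k l) (R k 1) (R 1 l) (R 1 1)"
    unfolding R L_minus L_plus L_central[OF central(1)] L_central[OF central(2)]
      L_central[OF central(3)] L_central[OF central(4)]
    unfolding e1 e_def[symmetric] A B C D mixed_defect_def \<sigma>_def Z1 Z2 ..
  moreover have "R k' l' \<in> J" if "k' \<in> {1..N}" "l' \<in> {1..N}" for k' l'
    unfolding R_def using that i j by (intro rel) auto
  then have "L (R k l) (R k 1) (R 1 l) (R 1 1) \<in> J"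
    unfolding L_def using k l by (intro mem_intros) auto
  ultimately show ?thesis by simp
qed

lemma Yv_row [simp]: "Yv 1 l = 0" and Yv_col [simp]: "Yv k 1 = 0"
  and Yu_row [simp]: "Yu 1 l = 0" and Yu_col [simp]: "Yu k 1 = 0"
  by (simp_all add: Yv_def Yu_def mult.assoc inv_simps inv_u inv_v del: One_nat_def)

lemma corner_commutes_mem:
  assumes k: "k \<in> {2..<N}" and l: "l \<in> {2..<N}"
  shows "U 1 1 * Yv k l - Yv k l * U 1 1 \<in> J"
proof -
  have "mixed_defect 1 1 k l \<in> J"
    using assms by (intro mixed_defect_mem) auto
  moreover have "sigma_sign \<pi> 1 1 k l = (1::'a)"
    by (cases "\<pi> 1") (simp_all add: sigma_sign_def sgn_bit_def)
  moreover have "\<not> k = 1 + N - 1" "\<not> 1 = 1 + N - l" "\<not> 1 = 1 + N - 1"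
    using assms by auto
  ultimately have "\<alpha> * (U 1 1 * Yv k l - Yv k l * U 1 1) \<in> J"
    by (simp add: mixed_defect_def Yv_row Yv_col del: One_nat_def)
  then show ?thesis by (rule cancel)
qed

text \<open>The operator \<open>L\<close> below does for the first argument what the one in the preceding proof does
  for the second.  Applied to the four mixed defects it gives the defect of the Schur complement
  up to \<open>X\<close> and \<open>D'\<close>, which arise because the pivots \<open>F\<close> and \<open>E\<close> are taken at \<open>v\<close> in the mixed
  defects and at \<open>u\<close> in the Schur complement.  Here \<open>X\<close> is a combination of supercommutators of
  \<open>x\<^sub>1\<^sub>j(u)\<close> with \<open>y\<^sub>i\<^sub>l(v)\<close>, of \<open>x\<^sub>i\<^sub>1(u)\<close> with \<open>y\<^sub>k\<^sub>j(v)\<close>, and of the corner entry with entries of \<open>y(v)\<close>; two more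
  mixed defects and the commutation of the corner entry evaluate \<open>\<alpha> * X\<close> as a multiple of \<open>D'\<close>.  Since this uses the coefficient \<open>\<alpha>\<close> a second time, what is shown is
  that \<open>\<alpha>\<close> times the defect lies in \<open>J\<close>.\<close>
lemma schur_defect_mem:
  assumes i: "i \<in> {2..<N}" and j: "j \<in> {2..<N}" and k: "k \<in> {2..<N}" and l: "l \<in> {2..<N}"
  shows "exchange_defect \<pi> 2 (N - 1) \<alpha> \<beta> \<gamma> \<kappa>
    (\<lambda>i j k l. Yu i j * Yv k l) (\<lambda>k l i j. Yv k l * Yu i j) i j k l \<in> J" (is "?Y \<in> J")
proof -
  define t where "t = (sigma_sign \<pi> 1 j k l :: 'a)"
  define s where "s = (sigma_sign \<pi> 1 j i l :: 'a)"
  define s' where "s' = (sigma_sign \<pi> i 1 k j :: 'a)"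
  define \<sigma> where "\<sigma> = (sigma_sign \<pi> i j k l :: 'a)"
  define e where "e = (eps_sign \<pi> i j k :: 'a)"
  define e1 where "e1 = (eps_sign \<pi> 1 j i :: 'a)"
  note sign_defs = t_def s_def s'_def \<sigma>_def e_def e1_def
  have tc: "t = 1 \<or> t = -1" and ec: "e = 1 \<or> e = -1" and \<sigma>c: "\<sigma> = 1 \<or> \<sigma> = -1"
    and sc: "s = 1 \<or> s = -1" and s'c: "s' = 1 \<or> s' = -1" and e1c: "e1 = 1 \<or> e1 = -1"
    unfolding sign_defs by (rule sigma_sign_cases eps_sign_cases)+
  have signs: "sigma_sign \<pi> i 1 k l = t * \<sigma>" "eps_sign \<pi> 1 j k = e * s'" "eps_sign \<pi> i 1 k = t * e * s"
      "eps_sign \<pi> i 1 k = s' * e1"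
    unfolding sign_defs eps_sign_def sigma_sign_def sgn_bit_add[symmetric]
    by (rule arg_cong[of _ _ sgn_bit], cases "\<pi> i"; cases "\<pi> j"; cases "\<pi> k"; cases "\<pi> 1"; cases "\<pi> l"; simp)+
  have s11: "sigma_sign \<pi> 1 1 k l = (1::'a)" for k l
    by (cases "\<pi> 1") (simp_all add: sigma_sign_def sgn_bit_def)
  \<comment> \<open>The signs \<open>s'\<close>, \<open>s\<close> and \<open>e * e1\<close> can differ from \<open>1\<close> only where the Kronecker delta
    next to them vanishes, because a delta forces the parities of its two indices to agree.\<close>
  have parity_eq: "\<pi> a = \<pi> b" if "a = 1 + N - b" "b \<in> {2..<N}" for a b
    using that sym[of b] by (simp add: add.commute)
  have s'\<delta>: "s' * of_bool (k = 1 + N - j) = of_bool (k = 1 + N - j)"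
    using parity_eq[OF _ j, of k] by (cases "\<pi> j") (auto simp: s'_def sigma_sign_def sgn_bit_def)
  have s\<delta>: "s * of_bool (i = 1 + N - l) = of_bool (i = 1 + N - l)"
    using parity_eq[OF _ l, of i] by (cases "\<pi> l") (auto simp: s_def sigma_sign_def sgn_bit_def)
  have ee1\<delta>: "e * e1 * of_bool (i = 1 + N - j) = of_bool (i = 1 + N - j)"
    using parity_eq[OF _ j, of i]
    by (cases "\<pi> j"; cases "\<pi> 1"; cases "\<pi> k") (auto simp: e_def e1_def eps_sign_def sgn_bit_def)
  have not_border: "\<not> i = 1 + N - 1" "\<not> k = 1 + N - 1" "\<not> 1 = 1 + N - j" "\<not> 1 = 1 + N - l" "\<not> 1 = 1 + N - 1"
    using i j k l N by auto
  define dF where "dF = Fu k - Fv k"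
  define dE where "dE = Eu l - Ev l"
  define K where "K i j = mixed_defect i j k l" for i j
  define A where "A i j k l = U i j * Yv k l - sigma_sign \<pi> i j k l * (Yv k l * U i j)" for i j k l
  define B where "B i j = Mr k j * Yv i l - Yv k j * Mc i l" for i j
  define S1 where "S1 i = (\<Sum>a \<in> {1..N}. U i (1 + N - a) * Yv a l)" for i
  define S2 where "S2 j = (\<Sum>a \<in> {1..N}. Yv k (1 + N - a) * U a j)" for j
  define D where "D = (\<Sum>a \<in> {1..N}. Mr k (1 + N - a) * Yv a l) - (\<Sum>a \<in> {1..N}. Yv k (1 + N - a) * Mc a l)"
  define D' where "D' = dF * S1 1 - S2 1 * dE"
  have K: "K i j = \<alpha> * A i j k l - \<beta> * (eps_sign \<pi> i j k * B i j)
     - \<gamma> * (eps_sign \<pi> i j k * (of_bool (k = 1 + N - j) * S1 i - of_bool (i = 1 + N - l) * S2 j))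
     + \<kappa> * (of_bool (i = 1 + N - j) * D)" for i j
    unfolding K_def mixed_defect_def A_def B_def S1_def S2_def D_def ..
  define L where "L w x y z = w - Fu i * x - t * (y * Eu j) + t * (Fu i * (z * Eu j))" for w x y z
  have L_central: "L (c * w) (c * x) (c * y) (c * z) = c * L w x y z" if "\<And>x. c * x = x * c" for c w x y z
  proof -
    have "x * (c * y) = c * (x * y)" for x y
      by (metis that mult.assoc)
    then show ?thesis using tc unfolding L_def by (auto simp: algebra_simps)
  qed
  have L_minus: "L (w - w') (x - x') (y - y') (z - z') = L w x y z - L w' x' y' z'"
    and L_plus: "L (w + w') (x + x') (y + y') (z + z') = L w x y z + L w' x' y' z'" for w w' x x' y y' z z'
    unfolding L_def by (simp_all add: algebra_simps)

  have LA: "L (A i j k l) (A 1 j k l) (A i 1 k l) (A 1 1 k l) = Yu i j * Yv k l - \<sigma> * (Yv k l * Yu i j)"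
    using tc \<sigma>c unfolding L_def A_def s11 signs t_def[symmetric] \<sigma>_def[symmetric]
    by (auto simp: Yu_def Fu_def Eu_def algebra_simps inv_simps inv_u simp del: One_nat_def)
  define X where "X = dF * (U 1 j * Yv i l - s * (U 1 1 * Yv i l * Eu j))
    + (s' * (Fu i * Yv k j * U 1 1) - Yv k j * U i 1) * dE"
  have B1: "B 1 j = - (Yv k j * U 1 1 * dE)"
    by (simp add: B_def Mc_def dE_def Eu_def algebra_simps inv_simps del: One_nat_def)
  have B2: "B i 1 = dF * U 1 1 * Yv i l"
    by (simp add: B_def Mr_def dF_def Fu_def algebra_simps inv_simps inv_u del: One_nat_def)
  have B3: "B 1 1 = 0"
    by (simp add: B_def del: One_nat_def)
  have Mr: "Mr k b = Yu k b + dF * U 1 b" and Mc: "Mc b l = Yu b l + U b 1 * dE" for b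
    by (simp_all add: Mr_def Mc_def Yu_def dF_def dE_def Fu_def Eu_def algebra_simps)
  have LB: "L (e * B i j) (e * s' * B 1 j) (t * e * s * B i 1) (z * B 1 1)
      = e * (Yu k j * Yv i l - Yv k j * Yu i l) + e * X" for z
    unfolding B1 B2 B3 L_def X_def B_def[of i j] Mr Mc using tc ec sc s'c
    by (auto simp: algebra_simps)
  have restrict: "(\<Sum>a \<in> {1..N}. f a) = (\<Sum>a \<in> {2..N - 1}. f a)" if "f 1 = 0" "f N = 0" for f :: "nat \<Rightarrow> 'a"
  proof (rule sum.mono_neutral_right)
    show "\<forall>a \<in> {1..N} - {2..N - 1}. f a = 0"
    proof
      fix a assume "a \<in> {1..N} - {2..N - 1}"
      then have "a = 1 \<or> a = N" by auto
      with that show "f a = 0" by blast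
    qed
  qed auto
  have N1: "1 + N - N = 1" using N by simp
  \<comment> \<open>The border terms vanish because the first row and the first column of \<open>y\<close> are zero.\<close>
  have YY1: "(\<Sum>a \<in> {1..N}. Yu b (1 + N - a) * Yv a l) = (\<Sum>a \<in> {2..N - 1}. Yu b (1 + N - a) * Yv a l)"
    and YY2: "(\<Sum>a \<in> {1..N}. Yv b (1 + N - a) * Yu a c) = (\<Sum>a \<in> {2..N - 1}. Yv b (1 + N - a) * Yu a c)"
    for b c
    by (rule restrict; simp only: N1 Yv_row Yv_col Yu_row Yu_col mult_zero_left mult_zero_right)+
  have S1: "S1 i - Fu i * S1 1 = (\<Sum>a \<in> {2..N - 1}. Yu i (1 + N - a) * Yv a l)"
    unfolding YY1[symmetric] S1_def sum_distrib_left sum_subtractf[symmetric]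
    by (simp add: Yu_def Fu_def algebra_simps)
  have S2: "S2 j - S2 1 * Eu j = (\<Sum>a \<in> {2..N - 1}. Yv k (1 + N - a) * Yu a j)"
    unfolding YY2[symmetric] S2_def sum_distrib_right sum_subtractf[symmetric]
    by (simp add: Yu_def Eu_def algebra_simps)
  have LC: "L (e * (of_bool (k = 1 + N - j) * S1 i - of_bool (i = 1 + N - l) * S2 j))
       (e * s' * (of_bool (k = 1 + N - j) * S1 1 - of_bool (1 = 1 + N - l) * S2 j))
       (t * e * s * (of_bool (k = 1 + N - 1) * S1 i - of_bool (i = 1 + N - l) * S2 1))
       (z * (of_bool (k = 1 + N - 1) * S1 1 - of_bool (1 = 1 + N - l) * S2 1))
     = e * (of_bool (k = 1 + N - j) * (\<Sum>a \<in> {2..N - 1}. Yu i (1 + N - a) * Yv a l)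
            - of_bool (i = 1 + N - l) * (\<Sum>a \<in> {2..N - 1}. Yv k (1 + N - a) * Yu a j))" for z
    unfolding S1[symmetric] S2[symmetric] L_def using tc ec sc s'c s\<delta> s'\<delta> not_border
    by (cases "k = 1 + N - j"; cases "i = 1 + N - l") (auto simp: algebra_simps simp del: One_nat_def)
  have D: "D = (\<Sum>a \<in> {2..N - 1}. Yu k (1 + N - a) * Yv a l)
       - (\<Sum>a \<in> {2..N - 1}. Yv k (1 + N - a) * Yu a l) + D'"
    unfolding YY1[symmetric] YY2[symmetric] D'_def D_def S1_def S2_def sum_distrib_left sum_distrib_right
      sum_subtractf[symmetric] sum.distrib[symmetric]
    by (simp add: Mr Mc algebra_simps)
  have LD: "L (of_bool (i = 1 + N - j) * D) (of_bool (1 = 1 + N - j) * D)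
      (of_bool (i = 1 + N - 1) * D) (of_bool (1 = 1 + N - 1) * D) = of_bool (i = 1 + N - j) * D"
    unfolding L_def using not_border by (simp del: One_nat_def)
  define G where "G = L (K i j) (K 1 j) (K i 1) (K 1 1)"
  have K_mem: "K i j \<in> J" "K 1 j \<in> J" "K i 1 \<in> J" "K 1 1 \<in> J"
    unfolding K_def using i j k l by (auto intro!: mixed_defect_mem simp del: One_nat_def)
  then have G_mem: "G \<in> J"
    unfolding G_def L_def by (intro mem_intros)
  have "G = \<alpha> * (Yu i j * Yv k l - \<sigma> * (Yv k l * Yu i j))
      - \<beta> * (e * (Yu k j * Yv i l - Yv k j * Yu i l) + e * X)
      - \<gamma> * (e * (of_bool (k = 1 + N - j) * (\<Sum>a \<in> {2..N - 1}. Yu i (1 + N - a) * Yv a l)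
            - of_bool (i = 1 + N - l) * (\<Sum>a \<in> {2..N - 1}. Yv k (1 + N - a) * Yu a j)))
      + \<kappa> * (of_bool (i = 1 + N - j) * D)"
    unfolding G_def K L_minus L_plus L_central[OF central(1)] L_central[OF central(2)]
      L_central[OF central(3)] L_central[OF central(4)]
    unfolding signs(1-3) e_def[symmetric] LA LB LC LD ..
  moreover have "2 + (N - 1) = 1 + N" using N by simp
  ultimately have Y: "?Y = G + \<beta> * (e * X) - \<kappa> * (of_bool (i = 1 + N - j) * D')"
    unfolding exchange_defect_def D \<sigma>_def e_def by (simp add: algebra_simps)

  \<comment> \<open>\<open>W\<close> measures to what extent \<open>\<alpha> * X\<close> is the multiple of \<open>D'\<close> that cancels the \<open>\<kappa>\<close> term.\<close>
  define W where "W = \<alpha> * X - \<gamma> * (e1 * (of_bool (i = 1 + N - j) * D'))"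
  have W: "W = dF * (mixed_defect 1 j i l - s * (\<alpha> * (A 1 1 i l * Eu j)))
     + s' * ((mixed_defect i 1 k j - Fu i * (\<alpha> * A 1 1 k j)) * dE)
     + \<beta> * (e1 * (dF * (A 1 1 i j * dE)))"
  proof -
    have K1: "mixed_defect 1 j i l = \<alpha> * A 1 j i l + \<beta> * (e1 * (Yv i j * U 1 1 * dE))
        - \<gamma> * (e1 * (of_bool (i = 1 + N - j) * S1 1))"
      using not_border unfolding mixed_defect_def A_def[symmetric] S1_def[symmetric] e1_def[symmetric]
      by (simp add: Mc_def dE_def Eu_def algebra_simps inv_simps del: One_nat_def)
    have K2: "mixed_defect i 1 k j = \<alpha> * A i 1 k j - \<beta> * (s' * e1 * (dF * U 1 1 * Yv i j))
        + \<gamma> * (s' * e1 * (of_bool (i = 1 + N - j) * S2 1))"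
      using not_border unfolding mixed_defect_def A_def[symmetric] S2_def[symmetric] signs(4)
      by (simp add: Mr_def dF_def Fu_def algebra_simps inv_simps inv_u del: One_nat_def)
    have X: "X = dF * (A 1 j i l - s * (A 1 1 i l * Eu j)) + s' * ((A i 1 k j - Fu i * A 1 1 k j) * dE)"
      unfolding X_def A_def s11 s_def[symmetric] s'_def[symmetric] using sc s'c
      by (auto simp: Fu_def Eu_def algebra_simps inv_simps inv_u simp del: One_nat_def)
    have c: "x * (\<alpha> * y) = \<alpha> * (x * y)" "x * (\<beta> * y) = \<beta> * (x * y)" "x * (\<gamma> * y) = \<gamma> * (x * y)" for x y
      by (metis central mult.assoc)+
    show ?thesis unfolding W_def X K1 K2 D'_def using e1c sc s'c
      by (cases "i = 1 + N - j") (auto simp: algebra_simps c A_def s11 simp del: One_nat_def)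
  qed
  have A_mem: "A 1 1 k l \<in> J" if "k \<in> {2..<N}" "l \<in> {2..<N}" for k l
    unfolding A_def s11 using corner_commutes_mem[OF that] by simp
  have "mixed_defect 1 j i l \<in> J" "mixed_defect i 1 k j \<in> J"
    using i j k l by (auto intro!: mixed_defect_mem simp del: One_nat_def)
  then have W_mem: "W \<in> J"
    unfolding W using i j k l by (intro mem_intros A_mem)
  have "\<alpha> * ?Y = \<alpha> * G + \<beta> * (e * W)"
  proof -
    have c: "x * (\<alpha> * y) = \<alpha> * (x * y)" for x y
      by (metis central(1) mult.assoc)
    have "\<beta> * (e * (\<gamma> * (e1 * (of_bool (i = 1 + N - j) * D')))) = \<kappa> * (\<alpha> * (e * e1 * of_bool (i = 1 + N - j) * D'))"
      using ec e1c coeffs by (auto simp flip: mult.assoc)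
    also have "\<dots> = \<alpha> * (\<kappa> * (of_bool (i = 1 + N - j) * D'))"
      unfolding ee1\<delta> c ..
    finally have "\<beta> * (e * W) = \<beta> * (e * (\<alpha> * X)) - \<alpha> * (\<kappa> * (of_bool (i = 1 + N - j) * D'))"
      by (simp add: W_def right_diff_distrib)
    then show ?thesis
      unfolding Y by (simp add: c algebra_simps)
  qed
  then have "\<alpha> * ?Y \<in> J"
    using G_mem W_mem by (auto intro: mem_intros)
  then show ?thesis by (rule cancel)
qed

end

context two_sided_ideal
begin

lemma exchange_defect_cong:
  assumes P: "\<And>i j k l. i \<in> {m..n} \<Longrightarrow> j \<in> {m..n} \<Longrightarrow> k \<in> {m..n} \<Longrightarrow> l \<in> {m..n} \<Longrightarrow> P i j k l \<approx> P' i j k l"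
    and Q: "\<And>i j k l. i \<in> {m..n} \<Longrightarrow> j \<in> {m..n} \<Longrightarrow> k \<in> {m..n} \<Longrightarrow> l \<in> {m..n} \<Longrightarrow> Q k l i j \<approx> Q' k l i j"
    and "i \<in> {m..n}" "j \<in> {m..n}" "k \<in> {m..n}" "l \<in> {m..n}"
  shows "exchange_defect \<pi> m n \<alpha> \<beta> \<gamma> \<kappa> P Q i j k l \<approx> exchange_defect \<pi> m n \<alpha> \<beta> \<gamma> \<kappa> P' Q' i j k l"
proof -
  have "m + n - a \<in> {m..n}" if "a \<in> {m..n}" for a
    using that by auto
  then show ?thesis
    unfolding exchange_defect_def
    by (intro cong_add cong_diff cong_mult cong_sum cong_refl P Q assms(3-6))
qed

end

lemma exchange_defect_scale:
  fixes \<alpha> \<beta> \<gamma> \<kappa> z :: "'a::ring_1"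
  assumes "z * \<alpha> = \<alpha> * z" "z * \<beta> = \<beta> * z" "z * \<gamma> = \<gamma> * z" "z * \<kappa> = \<kappa> * z"
  shows "exchange_defect \<pi> m n \<alpha> \<beta> \<gamma> \<kappa> (\<lambda>i j k l. z * P i j k l) (\<lambda>k l i j. z * Q k l i j) i j k l
    = z * exchange_defect \<pi> m n \<alpha> \<beta> \<gamma> \<kappa> P Q i j k l"
proof -
  have c: "z * (\<alpha> * y) = \<alpha> * (z * y)" "z * (\<beta> * y) = \<beta> * (z * y)" "z * (\<gamma> * y) = \<gamma> * (z * y)"
    "z * (\<kappa> * y) = \<kappa> * (z * y)" for y
    using assms by (metis mult.assoc)+
  have "e * (z * y) = z * (e * y)" if "e = 1 \<or> e = -1" for e y :: 'a
    using that by auto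
  note c = c this[OF eps_sign_cases] this[OF sigma_sign_cases]
  have "of_bool b * (z * y) = z * (of_bool b * y)" for b y
    by (cases b) auto
  note c = c this
  show ?thesis
    unfolding exchange_defect_def sum_distrib_left[symmetric]
    by (simp only: distrib_left right_diff_distrib c)
qed

section \<open>Series in two variables\<close>

text \<open>Two series over the quotient by \<open>I\<close> are equal when the coefficients of their difference lie in
  \<open>I\<close>.\<close>
definition fps_ideal :: "'a::ring_1 set \<Rightarrow> 'a fps set" where
  "fps_ideal I = {f. \<forall>n. fps_nth f n \<in> I}"

lemma two_sided_ideal_fps:
  assumes "two_sided_ideal I"
  shows "two_sided_ideal (fps_ideal I)"
proof -
  interpret two_sided_ideal I by (rule assms)
  show ?thesis
  proof
    fix x r :: "'a fps" assume "x \<in> fps_ideal I"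
    then show "r * x \<in> fps_ideal I" "x * r \<in> fps_ideal I"
      by (auto simp: fps_ideal_def fps_mult_nth intro: sum_mem mult_left_mem mult_right_mem)
  qed (auto simp: fps_ideal_def intro: zero_mem add_mem)
qed

definition p_ser :: "'a::ring_1 fps fps" where "p_ser = in_u fps_X"
definition q_ser :: "'a::ring_1 fps fps" where "q_ser = in_v fps_X"

lemma q_ser: "q_ser = fps_X"
  by (rule fps_ext) (simp add: q_ser_def in_v_def fps_X_nth)

lemma p_ser_mult: "p_ser * f = f * p_ser"
  by (rule fps_ext) (simp add: p_ser_def in_u_def fps_mult_fps_X_commute)

lemma q_ser_mult: "q_ser * f = f * q_ser"
  unfolding q_ser by (rule fps_mult_fps_X_commute)

lemma p_ser_mult_nth: "fps_nth (p_ser * f) n = fps_X * fps_nth f n"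
  by (simp add: p_ser_def in_u_def)

lemma in_u_simps: "in_u (f * g) = in_u f * in_u g" "in_u (f - g) = in_u f - in_u g" "in_u 1 = 1"
  by (simp_all add: in_u_def)

lemma in_v_simps: "in_v (f * g) = in_v f * in_v g" "in_v (f - g) = in_v f - in_v g" "in_v 1 = 1"
proof -
  have c: "fps_const (sum f A) = (\<Sum>x\<in>A. fps_const (f x))" for f :: "nat \<Rightarrow> 'a" and A
    by (induction A rule: infinite_finite_induct) (simp_all flip: fps_const_add)
  show "in_v (f * g) = in_v f * in_v g"
    by (rule fps_ext) (simp add: in_v_def fps_mult_nth c)
  show "in_v (f - g) = in_v f - in_v g" "in_v 1 = 1"
    by (rule fps_ext; simp add: in_v_def)+
qed

lemma in_u_in_v_nth:
  "fps_nth (fps_nth (in_u f * in_v g) b) a = fps_nth f a * fps_nth g b"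
  "fps_nth (fps_nth (in_v g * in_u f) b) a = fps_nth g b * fps_nth f a"
  by (simp_all add: in_u_def in_v_def)

abbreviation "ser_defect \<pi> m n \<equiv> exchange_defect \<pi> m n (q_ser^2 - p_ser^2)
   (p_ser * q_ser * (p_ser + q_ser)) (p_ser * q_ser * (q_ser - p_ser)) (p_ser^2 * q_ser^2)"

abbreviation "series_defect \<pi> m n X \<equiv>
  ser_defect \<pi> m n (\<lambda>i j k l. in_u (X i j) * in_v (X k l)) (\<lambda>k l i j. in_v (X k l) * in_u (X i j))"

lemma central_ser:
  fixes f :: "'a::ring_1 fps fps"
  shows "(q_ser^2 - p_ser^2) * f = f * (q_ser^2 - p_ser^2)"
   "(p_ser * q_ser * (p_ser + q_ser)) * f = f * (p_ser * q_ser * (p_ser + q_ser))"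
   "(p_ser * q_ser * (q_ser - p_ser)) * f = f * (p_ser * q_ser * (q_ser - p_ser))"
   "(p_ser^2 * q_ser^2) * f = f * (p_ser^2 * q_ser^2)"
proof -
  define C where "C = {z :: 'a fps fps. \<forall>f. z * f = f * z}"
  have add: "x + y \<in> C" and diff: "x - y \<in> C" if "x \<in> C" "y \<in> C" for x y
    using that unfolding C_def by (simp_all add: distrib_left distrib_right left_diff_distrib right_diff_distrib)
  have mult: "x * y \<in> C" if x: "x \<in> C" and y: "y \<in> C" for x y
  proof -
    have "(x * y) * f = f * (x * y)" for f
    proof -
      have "(x * y) * f = x * (f * y)" using y by (simp add: C_def mult.assoc)
      also have "\<dots> = (f * x) * y" using x by (simp add: C_def flip: mult.assoc)
      finally show ?thesis by (simp only: mult.assoc)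
    qed
    then show ?thesis by (simp add: C_def)
  qed
  have "p_ser \<in> C" "q_ser \<in> C"
    unfolding C_def using p_ser_mult q_ser_mult by auto
  then have "q_ser^2 - p_ser^2 \<in> C" "p_ser * q_ser * (p_ser + q_ser) \<in> C"
    "p_ser * q_ser * (q_ser - p_ser) \<in> C" "p_ser^2 * q_ser^2 \<in> C"
    unfolding power2_eq_square by (safe intro!: add diff mult)
  then show "(q_ser^2 - p_ser^2) * f = f * (q_ser^2 - p_ser^2)"
   "(p_ser * q_ser * (p_ser + q_ser)) * f = f * (p_ser * q_ser * (p_ser + q_ser))"
   "(p_ser * q_ser * (q_ser - p_ser)) * f = f * (p_ser * q_ser * (q_ser - p_ser))"
   "(p_ser^2 * q_ser^2) * f = f * (p_ser^2 * q_ser^2)"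
    unfolding C_def by blast+
qed

lemma coeffs_ser:
  "(p_ser * q_ser * (p_ser + q_ser)) * (p_ser * q_ser * (q_ser - p_ser))
   = (p_ser^2 * q_ser^2) * (q_ser^2 - p_ser^2 :: 'a::ring_1 fps fps)"
proof -
  have c: "q_ser * p_ser = p_ser * (q_ser :: 'a fps fps)" "q_ser * (p_ser * x) = p_ser * (q_ser * x)" for x :: "'a fps fps"
    by (metis p_ser_mult mult.assoc)+
  show ?thesis
    by (simp add: power2_eq_square algebra_simps c)
qed

text \<open>In \<open>(q\<^sup>2 - p\<^sup>2) f\<close> the coefficient of a power of \<open>p\<close> is \<open>q\<^sup>2\<close> times that of \<open>f\<close>, up to the coefficient
  of a lower power of \<open>p\<close> in \<open>f\<close>; hence the induction on the power of \<open>p\<close>.\<close>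
lemma cancel_square_diff:
  assumes "two_sided_ideal I" and f: "(q_ser^2 - p_ser^2) * f \<in> fps_ideal (fps_ideal I)"
  shows "f \<in> fps_ideal (fps_ideal I)"
proof -
  interpret two_sided_ideal I by (rule assms)
  have step: "fps_nth (fps_nth f b) a - (if a < 2 then 0 else fps_nth (fps_nth f (b + 2)) (a - 2)) \<in> I" for a b
  proof -
    have "fps_nth (fps_nth ((q_ser^2 - p_ser^2) * f) (b + 2)) a \<in> I"
      using f by (simp add: fps_ideal_def)
    moreover have "p_ser^2 * f = in_u (fps_X^2) * f"
      by (simp add: p_ser_def power2_eq_square in_u_simps)
    ultimately show ?thesis
      unfolding left_diff_distrib q_ser
      by (simp add: fps_X_power_mult_nth in_u_def del: fps_const_power split: if_splits)
  qed
  have "fps_nth (fps_nth f b) a \<in> I" for a b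
  proof (induction a arbitrary: b rule: less_induct)
    case (less a)
    have "(if a < 2 then 0 else fps_nth (fps_nth f (b + 2)) (a - 2)) \<in> I"
      using less zero_mem by auto
    from add_mem[OF step[of b a] this] show ?case by simp
  qed
  then show ?thesis by (simp add: fps_ideal_def)
qed

lemma cancel_sum:
  assumes "two_sided_ideal I" and f: "(p_ser + q_ser) * f \<in> fps_ideal (fps_ideal I)"
  shows "f \<in> fps_ideal (fps_ideal I)"
proof -
  interpret two_sided_ideal I by (rule assms)
  have step: "fps_nth (fps_nth f b) a + (if a = 0 then 0 else fps_nth (fps_nth f (b + 1)) (a - 1)) \<in> I" for a b
  proof -
    have "fps_nth (fps_nth ((p_ser + q_ser) * f) (b + 1)) a \<in> I"
      using f by (simp add: fps_ideal_def)
    then show ?thesis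
      unfolding distrib_right q_ser fps_add_nth p_ser_mult_nth by (simp add: add.commute split: if_splits)
  qed
  have "fps_nth (fps_nth f b) a \<in> I" for a b
  proof (induction a arbitrary: b)
    case 0
    then show ?case using step[of b 0] by simp
  next
    case (Suc a)
    from diff_mem[OF step[of b "Suc a"] Suc[of "b + 1"]] show ?case by simp
  qed
  then show ?thesis by (simp add: fps_ideal_def)
qed

section \<open>Shifting and specialising the variable\<close>

text \<open>The expansion of \<open>(u + c)\<^sup>-\<^sup>1\<close> in \<open>u\<^sup>-\<^sup>1\<close>.\<close>
definition shift_arg :: "int \<Rightarrow> 'a::ring_1 fps" where
  "shift_arg c = Abs_fps (\<lambda>r. if r = 0 then 0 else of_int ((- c) ^ (r - 1)))"

lemma shift_ser_nth: "fps_nth (shift_ser c f) n = (\<Sum>i = 0..n. fps_nth f i * fps_nth (shift_arg c ^ i) n)"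
  by (simp add: shift_ser_def shift_arg_def fps_compose_nth)

lemma shift_arg_eq: "(shift_arg c :: 'a::ring_1 fps) + of_int c * (fps_X * shift_arg c) = fps_X"
proof (rule fps_ext)
  fix n show "fps_nth (shift_arg c + of_int c * (fps_X * shift_arg c)) n = fps_nth (fps_X :: 'a fps) n"
  proof (cases n rule: nat.exhaust)
    case (Suc r)
    then show ?thesis
      by (cases r) (simp_all add: shift_arg_def fps_X_nth flip: fps_of_int)
  qed (simp add: shift_arg_def)
qed

text \<open>Substitution is compatible with products over a noncommutative ring only because the
  substituted series has central coefficients; here they are integers.\<close>
lemma shift_arg_power_nth_int: "\<exists>m. fps_nth (shift_arg c ^ i) n = (of_int m :: 'a::ring_1)"
proof (induction i arbitrary: n)
  case 0
  show ?case by (cases n) (auto intro: exI[of _ 0] exI[of _ 1])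
next
  case (Suc i)
  define m where "m k = (SOME m. fps_nth (shift_arg c ^ i) k = (of_int m :: 'a))" for k
  have m: "fps_nth (shift_arg c ^ i) k = (of_int (m k) :: 'a)" for k
    unfolding m_def using someI_ex[OF Suc] .
  have "fps_nth (shift_arg c ^ Suc i) n
      = (of_int (\<Sum>k = 0..n. (if k = 0 then 0 else (- c) ^ (k - 1)) * m (n - k)) :: 'a)"
    unfolding power_Suc fps_mult_nth m of_int_sum of_int_mult
    by (intro sum.cong) (simp_all add: shift_arg_def)
  then show ?case by blast
qed

lemma shift_arg_power_nth_central: "x * fps_nth (shift_arg c ^ i) n = fps_nth (shift_arg c ^ i) n * x"
  using shift_arg_power_nth_int[of c i n] mult_of_int_commute by metis

text \<open>The substitution \<open>u = v + c\<close>.  The coefficients of the outer series, which are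
  series in \<open>u\<^sup>-\<^sup>1\<close>, are shifted, and both variables are then identified.\<close>
definition specialise :: "int \<Rightarrow> 'a::ring_1 fps fps \<Rightarrow> 'a fps" where
  "specialise c G = Abs_fps (\<lambda>n. \<Sum>b = 0..n. fps_nth (shift_ser c (fps_nth G b)) (n - b))"

lemma shift_ser_diff: "shift_ser c (f - g) = shift_ser c f - shift_ser c g"
  by (rule fps_ext) (simp add: shift_ser_nth left_diff_distrib sum_subtractf)

lemma shift_ser_X_mult: "shift_ser c (fps_X * f) = shift_arg c * shift_ser c f"
proof (rule fps_ext)
  fix n
  let ?P = "shift_arg c :: 'a fps"
  have P0: "fps_nth (?P ^ i) m = 0" if "m < i" for i m
    using that by (intro startsby_zero_power_prefix[rule_format]) (simp_all add: shift_arg_def)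
  have "fps_nth (shift_arg c * shift_ser c f) n
      = (\<Sum>k = 0..n. \<Sum>i = 0..n - k. fps_nth f i * (fps_nth ?P k * fps_nth (?P ^ i) (n - k)))"
  proof -
    have "fps_nth ?P k * (y * z) = y * (fps_nth ?P k * z)" for k y z
      using shift_arg_power_nth_central[of y c 1 k] by (simp flip: mult.assoc)
    then show ?thesis
      unfolding fps_mult_nth shift_ser_nth sum_distrib_left by (intro sum.cong refl) blast
  qed
  also have "\<dots> = (\<Sum>k = 0..n. \<Sum>i = 0..n. fps_nth f i * (fps_nth ?P k * fps_nth (?P ^ i) (n - k)))"
    by (intro sum.cong sum.mono_neutral_left) (auto simp: P0)
  also have "\<dots> = (\<Sum>i = 0..n. fps_nth f i * fps_nth (?P ^ Suc i) n)"
    by (subst sum.swap) (simp add: fps_mult_nth sum_distrib_left)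
  also have "\<dots> = (\<Sum>i = 0..Suc n. fps_nth (fps_X * f) i * fps_nth (?P ^ i) n)"
    unfolding sum.atLeast0_atMost_Suc_shift by (simp del: power_Suc sum.cl_ivl_Suc)
  also have "\<dots> = fps_nth (shift_ser c (fps_X * f)) n"
    by (simp add: shift_ser_nth P0 del: power_Suc)
  finally show "fps_nth (shift_ser c (fps_X * f)) n = fps_nth (shift_arg c * shift_ser c f) n" ..
qed

lemma shift_ser_const_mult:
  "shift_ser c (f * fps_const z) = shift_ser c f * fps_const z"
  "shift_ser c (fps_const z * f) = fps_const z * shift_ser c f"
proof -
  have "x * z * fps_nth (shift_arg c ^ i) n = x * fps_nth (shift_arg c ^ i) n * z" for x i n
    using shift_arg_power_nth_central[of z c i n] by (simp add: mult.assoc)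
  then show "shift_ser c (f * fps_const z) = shift_ser c f * fps_const z"
    by (intro fps_ext) (simp add: shift_ser_nth sum_distrib_right)
  show "shift_ser c (fps_const z * f) = fps_const z * shift_ser c f"
    by (intro fps_ext) (simp add: shift_ser_nth sum_distrib_left mult.assoc)
qed

lemma specialise_diff: "specialise c (F - G) = specialise c F - specialise c G"
  by (rule fps_ext) (simp add: specialise_def shift_ser_diff sum_subtractf)

lemma specialise_p: "specialise c (p_ser * F) = shift_arg c * specialise c F"
proof (rule fps_ext)
  fix n
  have "fps_nth (shift_arg c * specialise c F) n
      = (\<Sum>k = 0..n. \<Sum>b = 0..n - k. fps_nth (shift_arg c) k * fps_nth (shift_ser c (fps_nth F b)) (n - k - b))"
    by (simp add: fps_mult_nth specialise_def sum_distrib_left)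
  also have "\<dots> = (\<Sum>b = 0..n. \<Sum>k = 0..n - b. fps_nth (shift_arg c) k * fps_nth (shift_ser c (fps_nth F b)) (n - k - b))"
    by (subst sum.Sigma, simp, simp, subst sum.Sigma, simp, simp,
        rule sum.reindex_bij_witness[of _ "\<lambda>(x, y). (y, x)" "\<lambda>(x, y). (y, x)"]) auto
  also have "\<dots> = fps_nth (specialise c (p_ser * F)) n"
    by (simp add: specialise_def p_ser_mult_nth shift_ser_X_mult) 
      (simp add: fps_mult_nth add.commute)
  finally show "fps_nth (specialise c (p_ser * F)) n = fps_nth (shift_arg c * specialise c F) n" ..
qed

lemma specialise_q: "specialise c (q_ser * F) = fps_X * specialise c F"
proof (rule fps_ext)
  fix n show "fps_nth (specialise c (q_ser * F)) n = fps_nth (fps_X * specialise c F) n"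
  proof (cases n)
    case 0
    then show ?thesis by (simp add: specialise_def q_ser shift_ser_nth)
  next
    case (Suc r)
    have "shift_ser c 0 = (0 :: 'a fps)" by (rule fps_ext) (simp add: shift_ser_nth)
    then show ?thesis
      unfolding Suc specialise_def fps_nth_Abs_fps sum.atLeast0_atMost_Suc_shift
      by (simp add: q_ser fps_nth_Abs_fps)
  qed
qed

lemma specialise_in_u_in_v: "specialise c (in_u f * in_v g) = shift_ser c f * g"
proof (rule fps_ext)
  fix n
  have "fps_nth (in_u f * in_v g) b = f * fps_const (fps_nth g b)" for b
    by (simp add: in_u_def in_v_def)
  then have "fps_nth (specialise c (in_u f * in_v g)) n
      = (\<Sum>b = 0..n. fps_nth (shift_ser c f) (n - b) * fps_nth g b)"
    by (simp add: specialise_def shift_ser_const_mult)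
  also have "\<dots> = fps_nth (shift_ser c f * g) n"
    unfolding fps_mult_nth by (subst sum.atLeastAtMost_rev) (auto intro!: sum.cong)
  finally show "fps_nth (specialise c (in_u f * in_v g)) n = fps_nth (shift_ser c f * g) n" .
qed

lemma specialise_in_v_in_u: "specialise c (in_v g * in_u f) = g * shift_ser c f"
proof (rule fps_ext)
  fix n
  have "fps_nth (in_v g * in_u f) b = fps_const (fps_nth g b) * f" for b
    by (simp add: in_u_def in_v_def)
  then show "fps_nth (specialise c (in_v g * in_u f)) n = fps_nth (g * shift_ser c f) n"
    by (simp add: specialise_def shift_ser_const_mult) (simp add: fps_mult_nth)
qed

lemma shift_ser_mem:
  assumes "two_sided_ideal I" and "f \<in> fps_ideal I"
  shows "shift_ser c f \<in> fps_ideal I"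
proof -
  interpret two_sided_ideal I by (rule assms)
  show ?thesis
    using assms(2) by (auto simp: fps_ideal_def shift_ser_nth intro: sum_mem mult_right_mem)
qed

lemma specialise_mem:
  assumes "two_sided_ideal I" and "F \<in> fps_ideal (fps_ideal I)"
  shows "specialise c F \<in> fps_ideal I"
proof -
  interpret two_sided_ideal I by (rule assms)
  have "shift_ser c (fps_nth F b) \<in> fps_ideal I" for b
    using assms by (intro shift_ser_mem) (simp_all add: fps_ideal_def)
  then show ?thesis
    by (auto simp: fps_ideal_def specialise_def intro: sum_mem)
qed

lemma shift_ser_commute_mem:
  assumes "two_sided_ideal I" and "\<And>r. fps_nth f r * z - z * fps_nth f r \<in> I"
  shows "fps_nth (shift_ser c f) n * z - z * fps_nth (shift_ser c f) n \<in> I"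
proof -
  interpret two_sided_ideal I by (rule assms)
  have "fps_nth (shift_ser c f) n * z - z * fps_nth (shift_ser c f) n
      = (\<Sum>i = 0..n. (fps_nth f i * z - z * fps_nth f i) * fps_nth (shift_arg c ^ i) n)"
    unfolding shift_ser_nth sum_distrib_left sum_distrib_right sum_subtractf[symmetric]
    by (intro sum.cong refl) (simp add: left_diff_distrib mult.assoc flip: shift_arg_power_nth_central[of z])
  then show ?thesis
    using assms(2) by (auto intro: sum_mem mult_right_mem)
qed

section \<open>The relations of the minors\<close>
locale twisted_yangian_series = two_sided_ideal I for I :: "'a::ring_1 set" +
  fixes N :: nat and s :: "nat \<Rightarrow> int" and X :: "nat \<Rightarrow> nat \<Rightarrow> 'a fps"
  assumes N: "N \<ge> 3" and parity: "parity_sequence N s" and symmetric: "symmetric_sequence N s"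
    and X0: "fps_nth (X 1 1) 0 = 1"
    and relation: "i \<in> {1..N} \<Longrightarrow> j \<in> {1..N} \<Longrightarrow> k \<in> {1..N} \<Longrightarrow> l \<in> {1..N} \<Longrightarrow>
      series_defect (parity s) 1 N X i j k l \<in> fps_ideal (fps_ideal I)"
begin

definition "corner_inv = fps_right_inverse (X 1 1) 1"
definition "Y k l = X k l - X k 1 * corner_inv * X 1 l"
definition "T i j = shift_ser (s 1) (X 1 1) * X i j - shift_ser (s 1) (X i 1) * X 1 j"

lemma corner_inv: "X 1 1 * corner_inv = 1" "corner_inv * X 1 1 = 1"
proof -
  show r: "X 1 1 * corner_inv = 1"
    unfolding corner_inv_def by (rule fps_right_inverse) (simp add: X0 del: One_nat_def)
  have l: "fps_left_inverse (X 1 1) 1 * X 1 1 = 1"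
    by (rule fps_left_inverse) (simp add: X0 del: One_nat_def)
  have "fps_left_inverse (X 1 1) 1 = fps_left_inverse (X 1 1) 1 * (X 1 1 * corner_inv)"
    unfolding r by simp
  also have "\<dots> = corner_inv"
    unfolding mult.assoc[symmetric] l by simp
  finally show "corner_inv * X 1 1 = 1" using l by simp
qed

interpretation ser: two_sided_ideal "fps_ideal I"
  by (intro two_sided_ideal_fps two_sided_ideal_axioms)

interpretation biser: two_sided_ideal "fps_ideal (fps_ideal I)"
  by (intro two_sided_ideal_fps two_sided_ideal_axioms)

interpretation schur: schur_complement "fps_ideal (fps_ideal I)"
  "q_ser^2 - p_ser^2" "p_ser * q_ser * (p_ser + q_ser)" "p_ser * q_ser * (q_ser - p_ser)" "p_ser^2 * q_ser^2"
  "parity s" N "\<lambda>i j. in_u (X i j)" "\<lambda>i j. in_v (X i j)" "in_u corner_inv" "in_v corner_inv"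
proof unfold_locales
  show "parity s (N + 1 - i) = parity s i" if "i \<in> {1..N}" for i
    using symmetric that by (simp add: symmetric_sequence_def parity_def)
  show "x \<in> fps_ideal (fps_ideal I)" if "(q_ser^2 - p_ser^2) * x \<in> fps_ideal (fps_ideal I)" for x
    using cancel_square_diff[OF two_sided_ideal_axioms that] .
qed ((rule central_ser coeffs_ser N relation; assumption)
    | simp only: corner_inv in_u_simps(3) in_v_simps(3) flip: in_u_simps(1) in_v_simps(1))+

lemma schur_Y: "schur.Yu k l = in_u (Y k l)" "schur.Yv k l = in_v (Y k l)"
  unfolding schur.Yu_def schur.Yv_def Y_def by (simp_all only: in_u_simps in_v_simps)

lemma Y_relation:
  assumes "i \<in> {2..<N}" "j \<in> {2..<N}" "k \<in> {2..<N}" "l \<in> {2..<N}"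
  shows "series_defect (parity s) 2 (N - 1) Y i j k l \<in> fps_ideal (fps_ideal I)"
  using schur.schur_defect_mem[OF assms] unfolding schur_Y .

text \<open>Coefficientwise, so that the roles of \<open>u\<close> and \<open>v\<close> can be exchanged and \<open>x\<^sub>1\<^sub>1\<close> can be shifted.\<close>
lemma corner_Y_commute:
  assumes "k \<in> {2..<N}" "l \<in> {2..<N}"
  shows "fps_nth (X 1 1) a * fps_nth (Y k l) b - fps_nth (Y k l) b * fps_nth (X 1 1) a \<in> I"
proof -
  have "fps_nth (fps_nth (in_u (X 1 1) * in_v (Y k l) - in_v (Y k l) * in_u (X 1 1)) b) a \<in> I"
    using schur.corner_commutes_mem[OF assms] unfolding schur_Y fps_ideal_def by blast
  then show ?thesis
    unfolding fps_sub_nth in_u_in_v_nth .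
qed

lemma corner_sign: "eps_sign (parity s) 1 1 k = (of_int (s 1) :: 'b::ring_1)" "s 1 = 1 \<or> s 1 = - 1"
proof -
  show "s 1 = 1 \<or> s 1 = - 1"
    using parity N by (auto simp: parity_sequence_def)
  then show "eps_sign (parity s) 1 1 k = (of_int (s 1) :: 'b)"
    by (cases "parity s k") (auto simp: eps_sign_def parity_def sgn_bit_def)
qed

text \<open>The relation of \<open>x\<^sub>1\<^sub>1(u)\<close> with \<open>x\<^sub>k\<^sub>1(v)\<close> involves \<open>1/(u - v)\<close> only, so that the factor \<open>p + q\<close> of the
  common denominator cancels.\<close>
lemma column_defect:
  assumes k: "k \<in> {1..<N}"
  shows "(q_ser - p_ser) * (in_u (X 1 1) * in_v (X k 1) - in_v (X k 1) * in_u (X 1 1))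
    - p_ser * (q_ser * (of_int (s 1) * (in_u (X k 1) * in_v (X 1 1) - in_v (X k 1) * in_u (X 1 1))))
    \<in> fps_ideal (fps_ideal I)" (is "?F \<in> _")
proof -
  have c: "q_ser * p_ser = p_ser * (q_ser :: 'a fps fps)" "q_ser * (p_ser * x) = p_ser * (q_ser * x)"
    for x :: "'a fps fps"
    by (metis p_ser_mult mult.assoc)+
  have "series_defect (parity s) 1 N X 1 1 k 1 \<in> fps_ideal (fps_ideal I)"
    using k by (intro relation) auto
  moreover have "sigma_sign (parity s) 1 1 k 1 = (1 :: 'a fps fps)"
    by (cases "parity s 1") (simp_all add: sigma_sign_def sgn_bit_def)
  moreover have "\<not> k = 1 + N - 1" "\<not> 1 = 1 + N - 1"
    using k N by auto
  ultimately have "(q_ser^2 - p_ser^2) * (in_u (X 1 1) * in_v (X k 1) - in_v (X k 1) * in_u (X 1 1))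
    - (p_ser * q_ser * (p_ser + q_ser)) * (of_int (s 1) * (in_u (X k 1) * in_v (X 1 1) - in_v (X k 1) * in_u (X 1 1)))
    \<in> fps_ideal (fps_ideal I)"
    by (simp add: exchange_defect_def corner_sign(1) del: One_nat_def)
  also have "(q_ser^2 - p_ser^2) * (in_u (X 1 1) * in_v (X k 1) - in_v (X k 1) * in_u (X 1 1))
    - (p_ser * q_ser * (p_ser + q_ser)) * (of_int (s 1) * (in_u (X k 1) * in_v (X 1 1) - in_v (X k 1) * in_u (X 1 1)))
    = (p_ser + q_ser) * ?F"
    by (simp add: power2_eq_square algebra_simps c del: One_nat_def)
  finally show ?thesis
    by (rule cancel_sum[OF two_sided_ideal_axioms])
qed

text \<open>Multiplied by \<open>u - v\<close>, the relation of \<open>x\<^sub>1\<^sub>1(u)\<close> with \<open>x\<^sub>k\<^sub>1(v)\<close> says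
  \<open>(u - v) [x\<^sub>1\<^sub>1(u), x\<^sub>k\<^sub>1(v)] = s\<^sub>1 (x\<^sub>k\<^sub>1(u) x\<^sub>1\<^sub>1(v) - x\<^sub>k\<^sub>1(v) x\<^sub>1\<^sub>1(u))\<close>.  At \<open>u = v + s\<^sub>1\<close> the
  products \<open>x\<^sub>k\<^sub>1(v) x\<^sub>1\<^sub>1(u)\<close> on the two sides cancel.  This is the reason for the shift by \<open>s\<^sub>1\<close>
  in \<open>\<T>\<^sub>i\<^sub>j(u)\<close>.\<close>
lemma column_shift:
  assumes k: "k \<in> {1..<N}"
  shows "shift_ser (s 1) (X 1 1) * X k 1 - shift_ser (s 1) (X k 1) * X 1 1 \<in> fps_ideal I" (is "?d \<in> _")
proof -
  define c where "c = s 1"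
  define P where "P = (shift_arg c :: 'a fps)"
  define x where "x = X k 1"
  define a where "a = X 1 1"
  have cc: "c = 1 \<or> c = - 1" unfolding c_def by (rule corner_sign)
  have XP: "P + of_int c * (fps_X * P) = fps_X"
    unfolding P_def by (rule shift_arg_eq)
  have sp: "specialise c (of_int c * F) = of_int c * specialise c F" for F :: "'a fps fps"
    using cc specialise_diff[of c 0 F] specialise_diff[of c F F] by auto
  have "specialise c ((q_ser - p_ser) * (in_u a * in_v x - in_v x * in_u a)
    - p_ser * (q_ser * (of_int c * (in_u x * in_v a - in_v x * in_u a)))) \<in> fps_ideal I"
    unfolding a_def x_def c_def by (intro specialise_mem two_sided_ideal_axioms column_defect k)
  also have "specialise c ((q_ser - p_ser) * (in_u a * in_v x - in_v x * in_u a)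
    - p_ser * (q_ser * (of_int c * (in_u x * in_v a - in_v x * in_u a))))
    = (fps_X - P) * (shift_ser c a * x - x * shift_ser c a)
      - P * (fps_X * (of_int c * (shift_ser c x * a - x * shift_ser c a)))"
    unfolding left_diff_distrib specialise_diff specialise_p specialise_q sp specialise_in_u_in_v
      specialise_in_v_in_u P_def ..
  also have "\<dots> = P * fps_X * (of_int c * (shift_ser c a * x - shift_ser c x * a))"
  proof -
    have XP': "fps_X - P = P * (fps_X * of_int c)"
      using XP fps_mult_fps_X_commute[of P] cc by (auto simp: algebra_simps)
    show ?thesis unfolding XP' using cc by (auto simp: algebra_simps)
  qed
  finally have "P * fps_X * (of_int c * ?d) \<in> fps_ideal I"
    unfolding c_def a_def x_def .
  then have "(1 + of_int c * fps_X) * (P * fps_X * (of_int c * ?d)) \<in> fps_ideal I"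
    by (rule ser.mult_left_mem)
  also have "(1 + of_int c * fps_X) * (P * fps_X * (of_int c * ?d)) = fps_X * (fps_X * (of_int c * ?d))"
  proof -
    have "(1 + of_int c * fps_X) * P = fps_X"
      using XP by (simp add: algebra_simps)
    then show ?thesis by (simp flip: mult.assoc)
  qed
  finally have "of_int c * (fps_X * (fps_X * (of_int c * ?d))) \<in> fps_ideal I"
    by (rule ser.mult_left_mem)
  also have "of_int c * (fps_X * (fps_X * (of_int c * ?d))) = fps_X * (fps_X * ?d)"
    using cc by (auto simp: algebra_simps)
  finally have "fps_nth (fps_X * (fps_X * ?d)) (Suc (Suc n)) \<in> I" for n
    unfolding fps_ideal_def by blast
  then show ?thesis
    by (simp add: fps_ideal_def)
qed

lemma T_cong_Y:
  assumes "i \<in> {1..<N}"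
  shows "T i j - shift_ser (s 1) (X 1 1) * Y i j \<in> fps_ideal I"
proof -
  have "T i j - shift_ser (s 1) (X 1 1) * Y i j
      = (shift_ser (s 1) (X 1 1) * X i 1 - shift_ser (s 1) (X i 1) * X 1 1) * (corner_inv * X 1 j)"
  proof -
    have "shift_ser (s 1) (X i 1) * X 1 1 * (corner_inv * X 1 j) = shift_ser (s 1) (X i 1) * (X 1 1 * corner_inv) * X 1 j"
      by (simp only: mult.assoc)
    also have "\<dots> = shift_ser (s 1) (X i 1) * X 1 j"
      unfolding corner_inv by simp
    finally show ?thesis
      unfolding T_def Y_def by (simp add: algebra_simps)
  qed
  then show ?thesis
    using column_shift[OF assms] by (simp only: ser.mult_right_mem)
qed

text \<open>The relation reads \<open>(u - v - s\<^sub>1) [x\<^sub>1\<^sub>1(u), x\<^sub>1\<^sub>1(v)] = 0\<close>, and the factor can be cancelled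
  coefficient by coefficient, starting from the constant coefficient in \<open>u\<^sup>-\<^sup>1\<close>.\<close>
lemma corner_commute: "fps_nth (X 1 1) a * fps_nth (X 1 1) b - fps_nth (X 1 1) b * fps_nth (X 1 1) a \<in> I"
proof -
  define M where "M = in_u (X 1 1) * in_v (X 1 1) - in_v (X 1 1) * in_u (X 1 1)"
  define m where "m b a = fps_nth (fps_nth M b) a" for b a
  have "(q_ser - p_ser) * M - p_ser * (q_ser * (of_int (s 1) * M)) \<in> fps_ideal (fps_ideal I)"
    unfolding M_def using N by (intro column_defect) simp
  then have *: "fps_nth (fps_nth ((q_ser - p_ser) * M - p_ser * (q_ser * (of_int (s 1) * M))) (Suc b)) a \<in> I" for b a
    unfolding fps_ideal_def by blast
  have step: "m b a - (if a = 0 then 0 else m (Suc b) (a - 1) + of_int (s 1) * m b (a - 1)) \<in> I" for b a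
    using *[of b a] corner_sign(2)
    unfolding left_diff_distrib fps_sub_nth p_ser_mult_nth
    by (auto simp: q_ser m_def diff_diff_eq split: if_splits)
  have "m b a \<in> I" for a b
  proof (induction a arbitrary: b)
    case 0
    then show ?case using step[of b 0] by simp
  next
    case (Suc a)
    have "m (Suc b) a + of_int (s 1) * m b a \<in> I"
      by (intro add_mem mult_left_mem Suc)
    from add_mem[OF step[of b "Suc a"], of "m (Suc b) a + of_int (s 1) * m b a"] this show ?case by simp
  qed
  then show ?thesis
    by (simp add: m_def M_def in_u_in_v_nth)
qed

text \<open>Both \<open>\<T>\<^sub>i\<^sub>j(u) \<T>\<^sub>k\<^sub>l(v)\<close> and \<open>\<T>\<^sub>k\<^sub>l(v) \<T>\<^sub>i\<^sub>j(u)\<close> are congruent to \<open>a(u + s\<^sub>1) a(v + s\<^sub>1)\<close> times the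
  corresponding product of entries of the Schur complement.\<close>
lemma T_relation:
  assumes ijkl: "i \<in> {2..N - 1}" "j \<in> {2..N - 1}" "k \<in> {2..N - 1}" "l \<in> {2..N - 1}"
  shows "series_defect (parity s) 2 (N - 1) T i j k l \<in> fps_ideal (fps_ideal I)"
proof -
  define h where "h = shift_ser (s 1) (X 1 1)"
  define z where "z = in_u h * in_v h"
  have comm: "fps_nth h a * fps_nth (Y k l) b - fps_nth (Y k l) b * fps_nth h a \<in> I"
    if "k \<in> {2..<N}" "l \<in> {2..<N}" for a b k l
    unfolding h_def using that by (intro shift_ser_commute_mem two_sided_ideal_axioms corner_Y_commute)
  have hh: "fps_nth h a * fps_nth h b - fps_nth h b * fps_nth h a \<in> I" for a b
    unfolding h_def
  proof (intro shift_ser_commute_mem two_sided_ideal_axioms)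
    fix r show "fps_nth (X 1 1) r * fps_nth (shift_ser (s 1) (X 1 1)) b - fps_nth (shift_ser (s 1) (X 1 1)) b * fps_nth (X 1 1) r \<in> I"
      using uminus_mem[OF shift_ser_commute_mem[OF two_sided_ideal_axioms corner_commute, of "s 1" b r]] by simp
  qed
  have Tu: "biser.cong (in_u (T i j)) (in_u h * in_u (Y i j))"
    and Tv: "biser.cong (in_v (T i j)) (in_v h * in_v (Y i j))" if "i \<in> {2..N - 1}" for i j
  proof -
    have "T i j - h * Y i j \<in> fps_ideal I"
      unfolding h_def using that by (intro T_cong_Y) auto
    then show "biser.cong (in_u (T i j)) (in_u h * in_u (Y i j))" "biser.cong (in_v (T i j)) (in_v h * in_v (Y i j))"
      unfolding biser.cong_def in_u_simps[symmetric] in_v_simps[symmetric]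
      by (auto simp: in_u_def in_v_def fps_ideal_def zero_mem)
  qed
  have uv: "biser.cong (in_u (Y k l) * in_v h) (in_v h * in_u (Y k l))"
    and vu: "biser.cong (in_v (Y k l) * in_u h) (in_u h * in_v (Y k l))" if "k \<in> {2..N - 1}" "l \<in> {2..N - 1}" for k l
  proof -
    have kl: "k \<in> {2..<N}" "l \<in> {2..<N}" using that by auto
    show "biser.cong (in_u (Y k l) * in_v h) (in_v h * in_u (Y k l))" "biser.cong (in_v (Y k l) * in_u h) (in_u h * in_v (Y k l))"
      unfolding biser.cong_def using comm[OF kl, THEN uminus_mem]
      by (simp_all add: fps_ideal_def in_u_in_v_nth)
  qed
  have huv: "biser.cong (in_v h * in_u h) (in_u h * in_v h)"
    unfolding biser.cong_def using hh by (simp add: fps_ideal_def in_u_in_v_nth)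
  have P: "biser.cong (in_u (T i j) * in_v (T k l)) (z * (in_u (Y i j) * in_v (Y k l)))"
    and Q: "biser.cong (in_v (T k l) * in_u (T i j)) (z * (in_v (Y k l) * in_u (Y i j)))"
    if "i \<in> {2..N - 1}" "j \<in> {2..N - 1}" "k \<in> {2..N - 1}" "l \<in> {2..N - 1}" for i j k l
  proof -
    have "biser.cong (in_u (T i j) * in_v (T k l)) ((in_u h * in_u (Y i j)) * (in_v h * in_v (Y k l)))"
      using that by (intro biser.cong_mult Tu Tv)
    also have "(in_u h * in_u (Y i j)) * (in_v h * in_v (Y k l)) = in_u h * (in_u (Y i j) * in_v h) * in_v (Y k l)"
      by (simp only: mult.assoc)
    also have "biser.cong \<dots> (in_u h * (in_v h * in_u (Y i j)) * in_v (Y k l))"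
      using that by (intro biser.cong_mult biser.cong_refl uv)
    finally show "biser.cong (in_u (T i j) * in_v (T k l)) (z * (in_u (Y i j) * in_v (Y k l)))"
      by (simp only: z_def mult.assoc)
    have "biser.cong (in_v (T k l) * in_u (T i j)) ((in_v h * in_v (Y k l)) * (in_u h * in_u (Y i j)))"
      using that by (intro biser.cong_mult Tu Tv)
    also have "(in_v h * in_v (Y k l)) * (in_u h * in_u (Y i j)) = in_v h * (in_v (Y k l) * in_u h) * in_u (Y i j)"
      by (simp only: mult.assoc)
    also have "biser.cong \<dots> (in_v h * (in_u h * in_v (Y k l)) * in_u (Y i j))"
      using that by (intro biser.cong_mult biser.cong_refl vu)
    also have "in_v h * (in_u h * in_v (Y k l)) * in_u (Y i j) = (in_v h * in_u h) * (in_v (Y k l) * in_u (Y i j))"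
      by (simp only: mult.assoc)
    also have "biser.cong \<dots> (z * (in_v (Y k l) * in_u (Y i j)))"
      unfolding z_def by (intro biser.cong_mult biser.cong_refl huv)
    finally show "biser.cong (in_v (T k l) * in_u (T i j)) (z * (in_v (Y k l) * in_u (Y i j)))" .
  qed
  have "biser.cong (series_defect (parity s) 2 (N - 1) T i j k l)
    (ser_defect (parity s) 2 (N - 1) (\<lambda>i j k l. z * (in_u (Y i j) * in_v (Y k l)))
        (\<lambda>k l i j. z * (in_v (Y k l) * in_u (Y i j))) i j k l)"
    by (intro biser.exchange_defect_cong P Q ijkl)
  also have "ser_defect (parity s) 2 (N - 1) (\<lambda>i j k l. z * (in_u (Y i j) * in_v (Y k l)))
        (\<lambda>k l i j. z * (in_v (Y k l) * in_u (Y i j))) i j k l = z * series_defect (parity s) 2 (N - 1) Y i j k l"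
    by (rule exchange_defect_scale) (rule central_ser[symmetric])+
  finally show ?thesis
    using ijkl by (elim biser.cong_mem, intro biser.mult_left_mem Y_relation) auto
qed

end

section \<open>Transport along homomorphisms\<close>
locale unital_hom =
  fixes h :: "'a::ring_1 \<Rightarrow> 'b::ring_1"
  assumes hom_add: "h (x + y) = h x + h y" and hom_mult: "h (x * y) = h x * h y" and hom_one: "h 1 = 1"
begin

lemma hom_zero: "h 0 = 0"
  using hom_add[of 0 0] by simp

lemma hom_minus: "h (- x) = - h x"
  using hom_add[of x "- x"] hom_zero by (simp add: eq_neg_iff_add_eq_0 add.commute)

lemma hom_diff: "h (x - y) = h x - h y"
  using hom_add[of x "- y"] by (simp add: hom_minus)

lemma hom_sum: "h (sum f A) = (\<Sum>a\<in>A. h (f a))"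
  by (induction A rule: infinite_finite_induct) (simp_all add: hom_zero hom_add)

lemma hom_power: "h (x ^ n) = h x ^ n"
  by (induction n) (simp_all add: hom_one hom_mult)

lemma hom_of_int: "h (of_int m) = of_int m"
  by (induction m rule: int_induct[of _ 0]) (simp_all add: hom_zero hom_one hom_add hom_diff)

lemma hom_of_bool: "h (of_bool b) = of_bool b"
  by (cases b) (simp_all add: hom_zero hom_one)

lemma hom_sgn_bit: "h (sgn_bit b) = sgn_bit b"
  by (cases b) (simp_all add: sgn_bit_def hom_one hom_minus)

lemma hom_eps_sign: "h (eps_sign \<pi> i j k) = eps_sign \<pi> i j k" and hom_sigma_sign: "h (sigma_sign \<pi> i j k l) = sigma_sign \<pi> i j k l"
  unfolding eps_sign_def sigma_sign_def by (rule hom_sgn_bit)+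

lemma hom_exchange_defect:
  "h (exchange_defect \<pi> m n \<alpha> \<beta> \<gamma> \<kappa> P Q i j k l) = exchange_defect \<pi> m n (h \<alpha>) (h \<beta>) (h \<gamma>) (h \<kappa>)
     (\<lambda>i j k l. h (P i j k l)) (\<lambda>k l i j. h (Q k l i j)) i j k l"
  unfolding exchange_defect_def
  by (simp only: hom_add hom_diff hom_mult hom_sum hom_of_bool hom_eps_sign hom_sigma_sign)

end

definition map_fps :: "('a::ring_1 \<Rightarrow> 'b::ring_1) \<Rightarrow> 'a fps \<Rightarrow> 'b fps" where
  "map_fps h f = Abs_fps (\<lambda>n. h (fps_nth f n))"

lemma map_fps_nth [simp]: "fps_nth (map_fps h f) n = h (fps_nth f n)"
  by (simp add: map_fps_def)

context unital_hom
begin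

lemma map_fps_hom: "unital_hom (map_fps h)"
proof
  fix x y :: "'a fps"
  show "map_fps h (x + y) = map_fps h x + map_fps h y"
    by (rule fps_ext) (simp add: hom_add)
  show "map_fps h (x * y) = map_fps h x * map_fps h y"
    by (rule fps_ext) (simp add: fps_mult_nth hom_sum hom_mult)
  show "map_fps h 1 = 1"
    by (rule fps_ext) (simp add: hom_one hom_zero)
qed

lemma map_fps_X: "map_fps h fps_X = fps_X"
  by (rule fps_ext) (simp add: fps_X_nth hom_one hom_zero)

lemma map_fps_shift_ser: "map_fps h (shift_ser c f) = shift_ser c (map_fps h f)"
proof (rule fps_ext)
  fix n
  interpret fh: unital_hom "map_fps h" by (rule map_fps_hom)
  have "map_fps h (shift_arg c) = shift_arg c"
    by (rule fps_ext) (simp only: map_fps_nth shift_arg_def fps_nth_Abs_fps if_distrib[of h] hom_zero hom_of_int)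
  then have "h (fps_nth (shift_arg c ^ i) n) = fps_nth (shift_arg c ^ i) n" for i
    by (metis fh.hom_power map_fps_nth)
  then show "fps_nth (map_fps h (shift_ser c f)) n = fps_nth (shift_ser c (map_fps h f)) n"
    by (simp add: shift_ser_nth hom_sum hom_mult)
qed

lemma series_defect_hom:
  "map_fps (map_fps h) (series_defect \<pi> m n X i j k l) = series_defect \<pi> m n (\<lambda>i j. map_fps h (X i j)) i j k l"
proof -
  interpret fh: unital_hom "map_fps h" by (rule map_fps_hom)
  interpret ffh: unital_hom "map_fps (map_fps h)" by (rule fh.map_fps_hom)
  have u: "map_fps (map_fps h) (in_u f) = in_u (map_fps h f)"
    and v: "map_fps (map_fps h) (in_v f) = in_v (map_fps h f)" for f
    by (intro fps_ext; simp add: in_u_def in_v_def hom_zero fh.hom_zero)+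
  have "map_fps (map_fps h) p_ser = p_ser" "map_fps (map_fps h) q_ser = q_ser"
    unfolding p_ser_def q_ser_def u v map_fps_X by (rule refl)+
  then show ?thesis
    by (simp only: ffh.hom_exchange_defect ffh.hom_mult ffh.hom_add ffh.hom_diff ffh.hom_power u v)
qed

end

text \<open>Congruence modulo the zero ideal is equality.\<close>
lemma series_defect_eqI:
  assumes "\<And>i j. i \<in> {m..n} \<Longrightarrow> j \<in> {m..n} \<Longrightarrow> X i j = Y i j"
    and "i \<in> {m..n}" "j \<in> {m..n}" "k \<in> {m..n}" "l \<in> {m..n}"
  shows "series_defect \<pi> m n X i j k l = series_defect \<pi> m n Y i j k l"
proof -
  interpret zero: two_sided_ideal "{0}"
    by unfold_locales auto
  have cong: "zero.cong x y \<longleftrightarrow> x = y" for x y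
    by (simp add: zero.cong_def)
  show ?thesis
    unfolding cong[symmetric]
    by (rule zero.exchange_defect_cong[OF _ _ assms(2-5)]) (simp_all only: cong assms(1))
qed

lemma relator_eq_series_defect: "relator s m n i j k l = series_defect (parity s) m n x_ser i j k l"
proof -
  define e where "e = (eps_sign (parity s) i j k :: free_alg fps fps)"
  have "e * x = x * e" for x
    unfolding e_def using eps_sign_cases[of "parity s" i j k, where 'a = "free_alg fps fps"] by auto
  then have "e * c * x = c * (e * x)" for c x
    by (metis mult.assoc)
  then show ?thesis
    unfolding relator_def Let_def exchange_defect_def eps_sign_def[symmetric] sigma_sign_def[symmetric]
      p_ser_def[symmetric] q_ser_def[symmetric] e_def[symmetric]
    by (simp add: of_bool_def)
qed

section \<open>The free algebra\<close>
abbreviation "scal c \<equiv> Poly_Mapping.single 0 c"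

lemma poly_mapping_sum: "f = (\<Sum>w \<in> Poly_Mapping.keys f. Poly_Mapping.single w (Poly_Mapping.lookup f w))"
  by (rule poly_mapping_eqI) (simp add: lookup_sum lookup_single when_def in_keys_iff)

lemma scal_central: "scal c * f = f * scal (c :: complex)"
proof -
  have "scal c * Poly_Mapping.single w b = Poly_Mapping.single w b * scal c" for w :: "'a :: monoid_add" and b
    by (simp add: mult_single mult.commute)
  then show ?thesis
    by (subst (1 2) poly_mapping_sum[of f]) (simp add: sum_distrib_left sum_distrib_right)
qed

definition free_lift :: "('g \<Rightarrow> 'h list \<Rightarrow>\<^sub>0 complex) \<Rightarrow> ('g list \<Rightarrow>\<^sub>0 complex) \<Rightarrow> ('h list \<Rightarrow>\<^sub>0 complex)" where
  "free_lift t f = (\<Sum>w \<in> Poly_Mapping.keys f. scal (Poly_Mapping.lookup f w) * prod_list (map t w))"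

lemma free_lift_superset:
  assumes "finite W" "Poly_Mapping.keys f \<subseteq> W"
  shows "free_lift t f = (\<Sum>w \<in> W. scal (Poly_Mapping.lookup f w) * prod_list (map t w))"
  unfolding free_lift_def using assms by (intro sum.mono_neutral_left) (auto simp: in_keys_iff)

lemma free_lift_add: "free_lift t (f + g) = free_lift t f + free_lift t g"
proof -
  let ?W = "Poly_Mapping.keys f \<union> Poly_Mapping.keys g"
  have "Poly_Mapping.keys (f + g) \<subseteq> ?W" by (rule Poly_Mapping.keys_add)
  then show ?thesis
    by (simp add: free_lift_superset[of ?W] lookup_add single_add distrib_right sum.distrib)
qed

lemma free_lift_single: "free_lift t (Poly_Mapping.single w c) = scal c * prod_list (map t w)"
  by (subst free_lift_superset[of "{w}"]) simp_all

lemma free_lift_hom: "unital_hom (free_lift t)"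
proof
  show "free_lift t (f + g) = free_lift t f + free_lift t g" for f g
    by (rule free_lift_add)
  show "free_lift t 1 = 1"
    using free_lift_single[of t 0 1] unfolding single_one by (simp add: zero_list_def)
  have sum: "free_lift t (sum F A) = (\<Sum>a\<in>A. free_lift t (F a))" for F :: "'c \<Rightarrow> _" and A
    by (induction A rule: infinite_finite_induct) (simp_all add: free_lift_add, simp_all add: free_lift_def)
  have single: "free_lift t (Poly_Mapping.single w b * Poly_Mapping.single w' b')
      = free_lift t (Poly_Mapping.single w b) * free_lift t (Poly_Mapping.single w' b')" for w w' b b'
  proof -
    have "scal (b * b') * (prod_list (map t w) * prod_list (map t w'))
        = scal b * (scal b' * prod_list (map t w)) * prod_list (map t w')"
      by (simp add: mult_single flip: mult.assoc)
    also have "\<dots> = (scal b * prod_list (map t w)) * (scal b' * prod_list (map t w'))"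
      unfolding scal_central[of b' "prod_list (map t w)"] by (simp only: mult.assoc)
    finally show ?thesis
      unfolding mult_single free_lift_single by (simp add: plus_list_def)
  qed
  show "free_lift t (f * g) = free_lift t f * free_lift t g" for f g
    by (subst (1 2) poly_mapping_sum[of f], subst (1 2) poly_mapping_sum[of g])
      (simp only: sum_product sum single)
qed

lemma free_lift_scal: "free_lift t (scal c * f) = scal c * free_lift t f"
proof -
  interpret unital_hom "free_lift t" by (rule free_lift_hom)
  show ?thesis by (simp add: hom_mult free_lift_single zero_list_def)
qed

lemma free_lift_gen: "free_lift t (Poly_Mapping.single [g] 1) = t g"
  by (simp add: free_lift_single)

lemma free_superalg_simps:
  "f \<otimes>\<^bsub>free_superalg G d\<^esub> g = f * g" "f \<oplus>\<^bsub>free_superalg G d\<^esub> g = f + g"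
  "\<one>\<^bsub>free_superalg G d\<^esub> = 1" "\<zero>\<^bsub>free_superalg G d\<^esub> = 0" "c \<odot>\<^bsub>free_superalg G d\<^esub> f = scal c * f"
  by (simp_all add: free_superalg_def mult_map_scale_conv_mult)

lemma scal_carrier: "scal c \<in> carrier (free_superalg G d)"
  by (simp add: free_superalg_def zero_list_def)

lemma gen_carrier: "g \<in> G \<Longrightarrow> Poly_Mapping.single [g] 1 \<in> carrier (free_superalg G d)"
  by (simp add: free_superalg_def)

lemma free_superalg_induct [consumes 1, case_names scal gen add mult]:
  assumes f: "f \<in> carrier (free_superalg G d)"
    and scal: "\<And>c. P (scal c)" and gen: "\<And>g. g \<in> G \<Longrightarrow> P (Poly_Mapping.single [g] 1)"
    and add: "\<And>f g. f \<in> carrier (free_superalg G d) \<Longrightarrow> g \<in> carrier (free_superalg G d) \<Longrightarrow> P f \<Longrightarrow> P g \<Longrightarrow> P (f + g)"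
    and mult: "\<And>f g. f \<in> carrier (free_superalg G d) \<Longrightarrow> g \<in> carrier (free_superalg G d) \<Longrightarrow> P f \<Longrightarrow> P g \<Longrightarrow> P (f * g)"
  shows "P f"
proof -
  let ?C = "carrier (free_superalg G d)"
  interpret ring "free_superalg G d" by (rule ring_free_superalg)
  note closed = a_closed[unfolded free_superalg_simps] m_closed[unfolded free_superalg_simps]
    zero_closed[unfolded free_superalg_simps]
  have P0: "P 0" using scal[of 0] by simp
  have word: "Poly_Mapping.single w c \<in> ?C \<and> P (Poly_Mapping.single w c)" if "set w \<subseteq> G" for w c
    using that
  proof (induction w)
    case Nil
    then show ?case using scal[of c] scal_carrier[of c G d] by (simp add: zero_list_def)
  next
    case (Cons g w)
    have "Poly_Mapping.single (g # w) c = Poly_Mapping.single [g] 1 * Poly_Mapping.single w c"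
      by (simp add: mult_single plus_list_def)
    with Cons show ?case by (auto intro: mult gen closed gen_carrier)
  qed
  have "(\<Sum>w \<in> A. Poly_Mapping.single w (Poly_Mapping.lookup f w)) \<in> ?C \<and>
      P (\<Sum>w \<in> A. Poly_Mapping.single w (Poly_Mapping.lookup f w))" if "A \<subseteq> Poly_Mapping.keys f" for A
  proof -
    have "finite A" using that by (rule finite_subset) simp
    then show ?thesis using that
    proof (induction A)
      case empty
      then show ?case using P0 closed(3) by simp
    next
      case (insert w A)
      have "set w \<subseteq> G" using f insert.prems by (auto simp: free_superalg_def)
      with insert word[of w] show ?case by (auto intro: add closed)
    qed
  qed
  then show ?thesis
    using poly_mapping_sum[of f] by (metis order_refl)
qed

lemma free_lift_carrier:
  assumes "f \<in> carrier (free_superalg G d)" and "\<And>g. g \<in> G \<Longrightarrow> t g \<in> carrier (free_superalg G' d')"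
  shows "free_lift t f \<in> carrier (free_superalg G' d')"
proof -
  interpret unital_hom "free_lift t" by (rule free_lift_hom)
  interpret ring "free_superalg G' d'" by (rule ring_free_superalg)
  note closed = a_closed[unfolded free_superalg_simps] m_closed[unfolded free_superalg_simps]
    one_closed[unfolded free_superalg_simps]
  show ?thesis using assms(1)
  proof (induction rule: free_superalg_induct)
    case (scal c)
    show ?case using free_lift_scal[of t c 1] scal_carrier[of c G' d'] by (simp add: hom_one)
  qed (simp_all add: free_lift_gen assms(2) hom_add hom_mult closed)
qed

text \<open>Killing the generators outside \<open>G\<close> is a projection onto the subalgebra generated by \<open>G\<close>.  It
  characterises the carrier by an equation, which any homomorphic construction
  inherits, and it extends ideals of the subalgebra to ideals of the whole type.\<close>
definition retract :: "'g set \<Rightarrow> ('g list \<Rightarrow>\<^sub>0 complex) \<Rightarrow> ('g list \<Rightarrow>\<^sub>0 complex)" where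
  "retract G = free_lift (\<lambda>g. if g \<in> G then Poly_Mapping.single [g] 1 else 0)"

lemma retract_hom: "unital_hom (retract G)"
  unfolding retract_def by (rule free_lift_hom)

lemma retract_carrier: "retract G f \<in> carrier (free_superalg G d)"
proof -
  interpret ring "free_superalg G d" by (rule ring_free_superalg)
  have "f \<in> carrier (free_superalg UNIV d)" by (simp add: free_superalg_def)
  then show ?thesis
    unfolding retract_def
    by (rule free_lift_carrier) (use zero_closed in \<open>simp add: gen_carrier free_superalg_simps\<close>)
qed

lemma retract_ident:
  assumes "f \<in> carrier (free_superalg G d)"
  shows "retract G f = f"
proof -
  interpret unital_hom "retract G" by (rule retract_hom)
  show ?thesis using assms
  proof (induction rule: free_superalg_induct)
    case (scal c)
    show ?case by (simp add: retract_def free_lift_single zero_list_def)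
  next
    case (gen g)
    then show ?case by (simp add: retract_def free_lift_gen)
  qed (simp_all add: hom_add hom_mult)
qed

lemma retract_fixed_carrier: "retract G f = f \<Longrightarrow> f \<in> carrier (free_superalg G d)"
  using retract_carrier[of G f d] by simp

section \<open>The extended twisted super Yangian as a quotient\<close>
lemma free_yangian_simps:
  "f \<otimes>\<^bsub>free_yangian s m n\<^esub> g = f * g" "f \<oplus>\<^bsub>free_yangian s m n\<^esub> g = f + g"
  "\<one>\<^bsub>free_yangian s m n\<^esub> = 1" "\<zero>\<^bsub>free_yangian s m n\<^esub> = 0" "c \<odot>\<^bsub>free_yangian s m n\<^esub> f = scal c * f"
  unfolding free_yangian_def by (rule free_superalg_simps)+

lemma ring_free_yangian: "ring (free_yangian s m n)"
  unfolding free_yangian_def by (rule ring_free_superalg)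

lemma minus_carrier: "f \<in> carrier (free_yangian s m n) \<Longrightarrow> - f \<in> carrier (free_yangian s m n)"
  by (simp add: free_yangian_def free_superalg_def)

lemma a_inv_free_yangian:
  assumes "f \<in> carrier (free_yangian s m n)"
  shows "\<ominus>\<^bsub>free_yangian s m n\<^esub> f = - f"
proof -
  interpret ring "free_yangian s m n" by (rule ring_free_yangian)
  show ?thesis
    using assms minus_carrier[OF assms] by (intro minus_equality) (simp_all add: free_yangian_simps)
qed

lemma free_yangian_one: "1 \<in> carrier (free_yangian s m n)"
  using ring.ring_simprules(6)[OF ring_free_yangian, of s m n] by (simp add: free_yangian_simps)

lemma free_yangian_closed:
  assumes "f \<in> carrier (free_yangian s m n)" "g \<in> carrier (free_yangian s m n)"
  shows "f + g \<in> carrier (free_yangian s m n)" "f * g \<in> carrier (free_yangian s m n)"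
    "f - g \<in> carrier (free_yangian s m n)"
proof -
  interpret ring "free_yangian s m n" by (rule ring_free_yangian)
  note closed = a_closed[unfolded free_yangian_simps] m_closed[unfolded free_yangian_simps]
  show "f + g \<in> carrier (free_yangian s m n)" "f * g \<in> carrier (free_yangian s m n)"
    using assms by (simp_all add: closed)
  show "f - g \<in> carrier (free_yangian s m n)"
    using closed(1)[OF assms(1) minus_carrier[OF assms(2)]] by simp
qed

lemma free_yangian_scal:
  "scal c \<in> carrier (free_yangian s m n)"
  "f \<in> carrier (free_yangian s m n) \<Longrightarrow> scal c * f \<in> carrier (free_yangian s m n)"
proof -
  show "scal c \<in> carrier (free_yangian s m n)"
    unfolding free_yangian_def by (rule scal_carrier)
  then show "f \<in> carrier (free_yangian s m n) \<Longrightarrow> scal c * f \<in> carrier (free_yangian s m n)"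
    by (rule free_yangian_closed)
qed

lemma x_ser_carrier:
  assumes "i \<in> {m..n}" "j \<in> {m..n}"
  shows "fps_nth (x_ser i j) r \<in> carrier (free_yangian s m n)"
  using assms by (auto simp: x_ser_def free_yangian_def free_superalg_def gens_def zero_list_def)

lemma retract_x_ser:
  assumes "i \<in> {m..n}" "j \<in> {m..n}"
  shows "map_fps (retract (gens m n)) (x_ser i j) = x_ser i j"
proof (rule fps_ext)
  fix r show "fps_nth (map_fps (retract (gens m n)) (x_ser i j)) r = fps_nth (x_ser i j) r"
    using retract_ident[OF x_ser_carrier[OF assms, of r, unfolded free_yangian_def]] by simp
qed

text \<open>The projection onto the carrier fixes the generating series, hence the relators built from
  them.\<close>
lemma relators_carrier: "relators s m n \<subseteq> carrier (free_yangian s m n)"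
proof
  interpret unital_hom "retract (gens m n)" by (rule retract_hom)
  fix f assume "f \<in> relators s m n"
  then obtain i j k l a b where ijkl: "i \<in> {m..n}" "j \<in> {m..n}" "k \<in> {m..n}" "l \<in> {m..n}"
    and f: "f = fps_nth (fps_nth (series_defect (parity s) m n x_ser i j k l) b) a"
    unfolding relators_def relator_eq_series_defect by blast
  have "retract (gens m n) f
      = fps_nth (fps_nth (series_defect (parity s) m n (\<lambda>i j. map_fps (retract (gens m n)) (x_ser i j)) i j k l) b) a"
    unfolding f series_defect_hom[symmetric] by simp
  also have "\<dots> = f"
    unfolding f by (subst series_defect_eqI[OF retract_x_ser ijkl]) simp_all
  finally show "f \<in> carrier (free_yangian s m n)"
    unfolding free_yangian_def by (rule retract_fixed_carrier)
qed

lemma ideal_yangian_ideal: "ideal (yangian_ideal s m n) (free_yangian s m n)"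
proof -
  interpret ring "free_yangian s m n" by (rule ring_free_yangian)
  show ?thesis
    unfolding yangian_ideal_def by (rule genideal_ideal) (rule relators_carrier)
qed

lemma relators_yangian_ideal: "relators s m n \<subseteq> yangian_ideal s m n"
proof -
  interpret ring "free_yangian s m n" by (rule ring_free_yangian)
  show ?thesis
    unfolding yangian_ideal_def by (rule genideal_self) (rule relators_carrier)
qed

lemma yangian_ideal_closed:
  shows "f \<in> yangian_ideal s m n \<Longrightarrow> g \<in> yangian_ideal s m n \<Longrightarrow> f + g \<in> yangian_ideal s m n"
    and "f \<in> yangian_ideal s m n \<Longrightarrow> r \<in> carrier (free_yangian s m n) \<Longrightarrow> r * f \<in> yangian_ideal s m n"
    and "f \<in> yangian_ideal s m n \<Longrightarrow> r \<in> carrier (free_yangian s m n) \<Longrightarrow> f * r \<in> yangian_ideal s m n"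
    and "f \<in> yangian_ideal s m n \<Longrightarrow> f \<in> carrier (free_yangian s m n)"
    and "0 \<in> yangian_ideal s m n"
    and "f \<in> yangian_ideal s m n \<Longrightarrow> - f \<in> yangian_ideal s m n"
proof -
  interpret ideal "yangian_ideal s m n" "free_yangian s m n" by (rule ideal_yangian_ideal)
  show "f \<in> yangian_ideal s m n \<Longrightarrow> g \<in> yangian_ideal s m n \<Longrightarrow> f + g \<in> yangian_ideal s m n"
    using additive_subgroup.a_closed[OF additive_subgroup_axioms, of f g] by (simp add: free_yangian_simps)
  show "f \<in> yangian_ideal s m n \<Longrightarrow> r \<in> carrier (free_yangian s m n) \<Longrightarrow> r * f \<in> yangian_ideal s m n"
    using I_l_closed[of f r] by (simp add: free_yangian_simps)
  show "f \<in> yangian_ideal s m n \<Longrightarrow> r \<in> carrier (free_yangian s m n) \<Longrightarrow> f * r \<in> yangian_ideal s m n"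
    using I_r_closed[of f r] by (simp add: free_yangian_simps)
  show C: "f \<in> yangian_ideal s m n \<Longrightarrow> f \<in> carrier (free_yangian s m n)" for f
    by (rule a_Hcarr)
  show "0 \<in> yangian_ideal s m n"
    using additive_subgroup.zero_closed[OF additive_subgroup_axioms] by (simp add: free_yangian_simps)
  show "f \<in> yangian_ideal s m n \<Longrightarrow> - f \<in> yangian_ideal s m n"
    using additive_subgroup.a_inv_closed[OF additive_subgroup_axioms, of f] a_inv_free_yangian[OF C, of f] by simp
qed

lemma yangian_class_eq_iff:
  assumes "f \<in> carrier (free_yangian s m n)" "g \<in> carrier (free_yangian s m n)"
  shows "yangian_class s m n f = yangian_class s m n g \<longleftrightarrow> f - g \<in> yangian_ideal s m n"
proof -
  interpret ring "free_yangian s m n" by (rule ring_free_yangian)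
  show ?thesis
    using quotient_eq_iff_same_a_r_cos[OF ideal_yangian_ideal assms]
    by (simp add: yangian_class_def a_minus_def a_inv_free_yangian assms free_yangian_simps)
qed

lemma yangian_class_self: "f \<in> yangian_class s m n f"
  using yangian_ideal_closed(5)[of s m n]
  by (auto simp: yangian_class_def a_r_coset_def' free_yangian_simps intro!: bexI[of _ 0])

lemma yangian_class_mem:
  assumes "f \<in> carrier (free_yangian s m n)" "g \<in> yangian_class s m n f"
  shows "g \<in> carrier (free_yangian s m n)" "yangian_class s m n g = yangian_class s m n f"
proof -
  obtain h where h: "h \<in> yangian_ideal s m n" "g = h + f"
    using assms(2) by (auto simp: yangian_class_def a_r_coset_def' free_yangian_simps)
  show g: "g \<in> carrier (free_yangian s m n)"
    using h yangian_ideal_closed(4) assms(1) by (simp add: free_yangian_closed)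
  show "yangian_class s m n g = yangian_class s m n f"
    using yangian_class_eq_iff[OF g assms(1)] h by simp
qed

lemma yangian_one: "\<one>\<^bsub>ext_twisted_super_yangian s m n\<^esub> = yangian_class s m n 1"
  by (simp add: ext_twisted_super_yangian_def quot_superalg_def FactRing_def yangian_class_def free_yangian_simps)

lemma yangian_simps:
  assumes "f \<in> carrier (free_yangian s m n)" "g \<in> carrier (free_yangian s m n)"
  shows "yangian_class s m n f \<otimes>\<^bsub>ext_twisted_super_yangian s m n\<^esub> yangian_class s m n g = yangian_class s m n (f * g)"
    "yangian_class s m n f \<oplus>\<^bsub>ext_twisted_super_yangian s m n\<^esub> yangian_class s m n g = yangian_class s m n (f + g)"
proof -
  interpret ideal "yangian_ideal s m n" "free_yangian s m n" by (rule ideal_yangian_ideal)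
  show "yangian_class s m n f \<otimes>\<^bsub>ext_twisted_super_yangian s m n\<^esub> yangian_class s m n g = yangian_class s m n (f * g)"
    using rcoset_mult_add[OF assms]
    by (simp add: ext_twisted_super_yangian_def quot_superalg_def FactRing_def yangian_class_def free_yangian_simps)
  show "yangian_class s m n f \<oplus>\<^bsub>ext_twisted_super_yangian s m n\<^esub> yangian_class s m n g = yangian_class s m n (f + g)"
    using a_rcos_sum[OF assms]
    by (simp add: ext_twisted_super_yangian_def quot_superalg_def FactRing_def yangian_class_def free_yangian_simps)
qed

lemma yangian_smult:
  assumes f: "f \<in> carrier (free_yangian s m n)"
  shows "c \<odot>\<^bsub>ext_twisted_super_yangian s m n\<^esub> yangian_class s m n f = yangian_class s m n (scal c * f)"
proof -
  have "c \<odot>\<^bsub>ext_twisted_super_yangian s m n\<^esub> yangian_class s m n f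
      = (\<Union>x \<in> yangian_class s m n f. yangian_class s m n (scal c * x))"
    by (simp add: ext_twisted_super_yangian_def quot_superalg_def yangian_class_def free_yangian_simps)
  also have "yangian_class s m n (scal c * x) = yangian_class s m n (scal c * f)"
    if "x \<in> yangian_class s m n f" for x
  proof -
    have x: "x \<in> carrier (free_yangian s m n)" "x - f \<in> yangian_ideal s m n"
      using yangian_class_mem[OF f that] yangian_class_eq_iff[OF _ f] by auto
    from yangian_ideal_closed(2)[OF x(2) free_yangian_scal(1)[of c]] show ?thesis
      using f x by (subst yangian_class_eq_iff) (simp_all add: free_yangian_scal right_diff_distrib)
  qed
  then have "(\<Union>x \<in> yangian_class s m n f. yangian_class s m n (scal c * x)) = yangian_class s m n (scal c * f)"
    using yangian_class_self[of f s m n] by blast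
  finally show "c \<odot>\<^bsub>ext_twisted_super_yangian s m n\<^esub> yangian_class s m n f = yangian_class s m n (scal c * f)" .
qed

lemma yangian_carrier: "carrier (ext_twisted_super_yangian s m n) = yangian_class s m n ` carrier (free_yangian s m n)"
  by (auto simp: ext_twisted_super_yangian_def quot_superalg_def FactRing_def A_RCOSETS_def' yangian_class_def)

lemma yangian_grade: "grade (ext_twisted_super_yangian s m n) p = yangian_class s m n ` grade (free_yangian s m n) p"
  by (simp add: ext_twisted_super_yangian_def quot_superalg_def yangian_class_def)

section \<open>The homomorphism\<close>

text \<open>The preimage of the defining ideal under the projection.  It is an ideal of the whole type,
  as the computations with series require, and meets the carrier in the defining ideal.\<close>
definition full_ideal :: "(nat \<Rightarrow> int) \<Rightarrow> nat \<Rightarrow> nat \<Rightarrow> free_alg set" where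
  "full_ideal s m n = {f. retract (gens m n) f \<in> yangian_ideal s m n}"

lemma two_sided_full_ideal: "two_sided_ideal (full_ideal s m n)"
proof -
  interpret unital_hom "retract (gens m n)" by (rule retract_hom)
  have C: "retract (gens m n) f \<in> carrier (free_yangian s m n)" for f
    unfolding free_yangian_def by (rule retract_carrier)
  show ?thesis
    by unfold_locales (simp_all add: full_ideal_def hom_zero hom_add hom_mult yangian_ideal_closed C)
qed

lemma full_ideal_carrier:
  "f \<in> carrier (free_yangian s m n) \<Longrightarrow> f \<in> full_ideal s m n \<longleftrightarrow> f \<in> yangian_ideal s m n"
  using retract_ident[of f "gens m n" "gen_parity s"] by (simp add: full_ideal_def flip: free_yangian_def)

lemma twisted_yangian_series_x_ser:
  assumes "N \<ge> 3" "parity_sequence N s" "symmetric_sequence N s"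
  shows "twisted_yangian_series (full_ideal s 1 N) N s x_ser"
proof -
  interpret two_sided_ideal "full_ideal s 1 N" by (rule two_sided_full_ideal)
  show ?thesis
  proof
    fix i j k l assume ijkl: "i \<in> {1..N}" "j \<in> {1..N}" "k \<in> {1..N}" "l \<in> {1..N}"
    have "fps_nth (fps_nth (relator s 1 N i j k l) b) a \<in> relators s 1 N" for a b
      using ijkl unfolding relators_def by blast
    then show "series_defect (parity s) 1 N x_ser i j k l \<in> fps_ideal (fps_ideal (full_ideal s 1 N))"
      unfolding fps_ideal_def relator_eq_series_defect mem_Collect_eq
      using relators_carrier full_ideal_carrier relators_yangian_ideal by blast
  qed (simp_all add: assms x_ser_def)
qed

lemma T_ser_relation:
  assumes "N \<ge> 3" "parity_sequence N s" "symmetric_sequence N s"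
    and "i \<in> {2..N - 1}" "j \<in> {2..N - 1}" "k \<in> {2..N - 1}" "l \<in> {2..N - 1}"
  shows "fps_nth (fps_nth (series_defect (parity s) 2 (N - 1) (T_ser s) i j k l) b) a \<in> full_ideal s 1 N"
proof -
  interpret twisted_yangian_series "full_ideal s 1 N" N s x_ser
    by (rule twisted_yangian_series_x_ser[OF assms(1-3)])
  have "T_ser s = T" by (intro ext) (simp add: T_ser_def T_def)
  then show ?thesis
    using T_relation[OF assms(4-7)] by (simp add: fps_ideal_def)
qed

lemma T_ser_carrier:
  assumes "i \<in> {1..N}" "j \<in> {1..N}"
  shows "fps_nth (T_ser s i j) r \<in> carrier (free_yangian s 1 N)"
proof -
  interpret unital_hom "retract (gens 1 N)" by (rule retract_hom)
  interpret fh: unital_hom "map_fps (retract (gens 1 N))" by (rule map_fps_hom)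
  have "map_fps (retract (gens 1 N)) (T_ser s i j) = T_ser s i j"
    unfolding T_ser_def fh.hom_diff fh.hom_mult map_fps_shift_ser
    using assms by (subst retract_x_ser, simp, simp)+ simp
  then have "retract (gens 1 N) (fps_nth (T_ser s i j) r) = fps_nth (T_ser s i j) r"
    by (metis map_fps_nth)
  then show ?thesis
    unfolding free_yangian_def by (rule retract_fixed_carrier)
qed

definition T_lift :: "(nat \<Rightarrow> int) \<Rightarrow> free_alg \<Rightarrow> free_alg" where
  "T_lift s = free_lift (\<lambda>(i, j, r). fps_nth (T_ser s i j) r)"

lemma T_lift_hom: "unital_hom (T_lift s)"
  unfolding T_lift_def by (rule free_lift_hom)

lemma T_lift_scal: "T_lift s (scal c * f) = scal c * T_lift s f"
  unfolding T_lift_def by (rule free_lift_scal)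

lemma T_lift_carrier:
  assumes "f \<in> carrier (free_yangian s 2 (N - 1))"
  shows "T_lift s f \<in> carrier (free_yangian s 1 N)"
  using assms unfolding T_lift_def free_yangian_def
proof (rule free_lift_carrier)
  fix g assume "g \<in> gens 2 (N - 1)"
  then obtain i j r where "g = (i, j, r)" "i \<in> {1..N}" "j \<in> {1..N}"
    by (auto simp: gens_def)
  with T_ser_carrier[of i N j s r]
  show "(case g of (i, j, r) \<Rightarrow> fps_nth (T_ser s i j) r) \<in> carrier (free_superalg (gens 1 N) (gen_parity s))"
    by (simp add: free_yangian_def)
qed

lemma T_lift_x_ser:
  assumes "i \<ge> 2" "j \<ge> 2"
  shows "map_fps (T_lift s) (x_ser i j) = T_ser s i j"
proof (rule fps_ext)
  interpret unital_hom "T_lift s" by (rule T_lift_hom)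
  fix r show "fps_nth (map_fps (T_lift s) (x_ser i j)) r = fps_nth (T_ser s i j) r"
  proof (cases "r = 0")
    case True
    with assms show ?thesis
      by (simp add: x_ser_def T_ser_def shift_ser_nth hom_one hom_zero)
  next
    case False
    then show ?thesis
      by (simp add: x_ser_def T_lift_def free_lift_gen)
  qed
qed

text \<open>The elements that are mapped into the target ideal form an ideal, and this ideal contains the
  relators: applied to a relator, the lift replaces \<open>x\<^sub>i\<^sub>j(u)\<close> by \<open>\<T>\<^sub>i\<^sub>j(u)\<close>.\<close>
lemma T_lift_ideal:
  assumes N: "N \<ge> 3" "parity_sequence N s" "symmetric_sequence N s"
    and f: "f \<in> yangian_ideal s 2 (N - 1)"
  shows "T_lift s f \<in> yangian_ideal s 1 N"
proof -
  interpret R: ring "free_yangian s 2 (N - 1)" by (rule ring_free_yangian)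
  interpret unital_hom "T_lift s" by (rule T_lift_hom)
  define K where "K = {f \<in> carrier (free_yangian s 2 (N - 1)). T_lift s f \<in> yangian_ideal s 1 N}"
  have "ideal K (free_yangian s 2 (N - 1))"
  proof (rule idealI[OF ring_free_yangian])
    show "subgroup K (add_monoid (free_yangian s 2 (N - 1)))"
    proof (rule R.add.subgroupI)
      have "0 \<in> K"
        using R.zero_closed yangian_ideal_closed(5) by (simp add: K_def hom_zero free_yangian_simps)
      then show "K \<noteq> {}" by blast
      show "\<ominus>\<^bsub>free_yangian s 2 (N - 1)\<^esub> f \<in> K" if "f \<in> K" for f
        using that a_inv_free_yangian[of f s 2 "N - 1"] minus_carrier[of f s 2 "N - 1"]
        by (simp add: K_def hom_minus yangian_ideal_closed)
    qed (auto simp: K_def hom_add free_yangian_simps free_yangian_closed yangian_ideal_closed)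
  qed (auto simp: K_def hom_mult free_yangian_simps free_yangian_closed yangian_ideal_closed T_lift_carrier
      simp del: One_nat_def)
  moreover have "relators s 2 (N - 1) \<subseteq> K"
  proof
    fix f assume f: "f \<in> relators s 2 (N - 1)"
    then obtain i j k l a b
      where ijkl: "i \<in> {2..N - 1}" "j \<in> {2..N - 1}" "k \<in> {2..N - 1}" "l \<in> {2..N - 1}"
      and f': "f = fps_nth (fps_nth (series_defect (parity s) 2 (N - 1) x_ser i j k l) b) a"
      unfolding relators_def relator_eq_series_defect by blast
    have "T_lift s f = fps_nth (fps_nth (series_defect (parity s) 2 (N - 1)
        (\<lambda>i j. map_fps (T_lift s) (x_ser i j)) i j k l) b) a"
      unfolding f' series_defect_hom[symmetric] by simp
    also have "\<dots> = fps_nth (fps_nth (series_defect (parity s) 2 (N - 1) (T_ser s) i j k l) b) a"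
      by (subst series_defect_eqI[OF T_lift_x_ser ijkl]) simp_all
    finally have "T_lift s f \<in> full_ideal s 1 N"
      using T_ser_relation[OF N ijkl] by simp
    moreover have "f \<in> carrier (free_yangian s 2 (N - 1))"
      using f relators_carrier by blast
    ultimately show "f \<in> K"
      using full_ideal_carrier[OF T_lift_carrier, of f s N] by (simp add: K_def)
  qed
  ultimately have "yangian_ideal s 2 (N - 1) \<subseteq> K"
    unfolding yangian_ideal_def by (rule R.genideal_minimal)
  with f show ?thesis by (auto simp: K_def)
qed

text \<open>The lift preserves parities because \<open>x\<^sub>1\<^sub>1 x\<^sub>i\<^sub>j\<close> and \<open>x\<^sub>i\<^sub>1 x\<^sub>1\<^sub>j\<close> both have parity \<open>|i| + |j|\<close>.\<close>
definition homogeneous :: "('g \<Rightarrow> bit) \<Rightarrow> bit \<Rightarrow> ('g list \<Rightarrow>\<^sub>0 complex) set" where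
  "homogeneous d p = {f. \<forall>w \<in> Poly_Mapping.keys f. sum_list (map d w) = p}"

lemma homogeneous_closed:
  shows "0 \<in> homogeneous d p" "scal c \<in> homogeneous d 0"
    and "f \<in> homogeneous d p \<Longrightarrow> g \<in> homogeneous d p \<Longrightarrow> f + g \<in> homogeneous d p"
    and "f \<in> homogeneous d p \<Longrightarrow> g \<in> homogeneous d p \<Longrightarrow> f - g \<in> homogeneous d p"
    and "f \<in> homogeneous d p \<Longrightarrow> g \<in> homogeneous d q \<Longrightarrow> f * g \<in> homogeneous d (p + q)"
proof -
  show "0 \<in> homogeneous d p" "scal c \<in> homogeneous d 0"
    by (simp_all add: homogeneous_def zero_list_def)
  show "f \<in> homogeneous d p \<Longrightarrow> g \<in> homogeneous d p \<Longrightarrow> f + g \<in> homogeneous d p"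
    using Poly_Mapping.keys_add[of f g] unfolding homogeneous_def by blast
  show "f \<in> homogeneous d p \<Longrightarrow> g \<in> homogeneous d p \<Longrightarrow> f - g \<in> homogeneous d p"
    using Poly_Mapping.keys_diff[of f g] unfolding homogeneous_def by blast
  show "f * g \<in> homogeneous d (p + q)" if "f \<in> homogeneous d p" "g \<in> homogeneous d q"
    unfolding homogeneous_def
  proof (intro CollectI ballI)
    fix w assume "w \<in> Poly_Mapping.keys (f * g)"
    then obtain a b where "w = a + b" "a \<in> Poly_Mapping.keys f" "b \<in> Poly_Mapping.keys g"
      using keys_mult[of f g] by blast
    with that show "sum_list (map d w) = p + q"
      by (simp add: homogeneous_def plus_list_def)
  qed
qed

lemma homogeneous_sum: "(\<And>a. a \<in> A \<Longrightarrow> F a \<in> homogeneous d p) \<Longrightarrow> sum F A \<in> homogeneous d p"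
  by (induction A rule: infinite_finite_induct) (auto intro: homogeneous_closed)

lemma homogeneous_of_int: "of_int m \<in> homogeneous d 0"
proof -
  have "scal (of_int m) = (of_int m :: 'a list \<Rightarrow>\<^sub>0 complex)" by (rule single_of_int)
  then show ?thesis using homogeneous_closed(2)[of "of_int m" d] by metis
qed

lemma homogeneous_shift_ser:
  assumes "\<And>r. fps_nth f r \<in> homogeneous d p"
  shows "fps_nth (shift_ser c f) r \<in> homogeneous d p"
proof -
  have "fps_nth f i * fps_nth (shift_arg c ^ i) r \<in> homogeneous d p" for i
  proof -
    obtain m where "fps_nth (shift_arg c ^ i) r = (of_int m :: 'a list \<Rightarrow>\<^sub>0 complex)"
      using shift_arg_power_nth_int by blast
    then show ?thesis
      using homogeneous_closed(5)[OF assms homogeneous_of_int, of i m] by (simp only: add_0_right)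
  qed
  then show ?thesis unfolding shift_ser_nth by (intro homogeneous_sum)
qed

lemma homogeneous_series_mult:
  assumes "\<And>r. fps_nth f r \<in> homogeneous d p" "\<And>r. fps_nth g r \<in> homogeneous d q"
  shows "fps_nth (f * g) r \<in> homogeneous d (p + q)"
  unfolding fps_mult_nth by (intro homogeneous_sum homogeneous_closed assms)

lemma homogeneous_x_ser: "fps_nth (x_ser i j) r \<in> homogeneous (gen_parity s) (parity s i + parity s j)"
  by (cases "parity s j") (auto simp: x_ser_def homogeneous_def gen_parity_def zero_list_def)

lemma homogeneous_T_ser: "fps_nth (T_ser s i j) r \<in> homogeneous (gen_parity s) (parity s i + parity s j)"
proof -
  note mult = homogeneous_series_mult[OF homogeneous_shift_ser[OF homogeneous_x_ser] homogeneous_x_ser]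
  have "parity s 1 + parity s 1 + (parity s i + parity s j) = parity s i + parity s j"
    "parity s i + parity s 1 + (parity s 1 + parity s j) = parity s i + parity s j"
    by (cases "parity s 1"; cases "parity s i"; cases "parity s j"; simp)+
  with mult[of "s 1" 1 1 i j r s] mult[of "s 1" i 1 1 j r s] show ?thesis
    unfolding T_ser_def fps_sub_nth by (intro homogeneous_closed) simp_all
qed

lemma T_lift_homogeneous:
  assumes "f \<in> homogeneous (gen_parity s) p"
  shows "T_lift s f \<in> homogeneous (gen_parity s) p"
  unfolding T_lift_def free_lift_def
proof (rule homogeneous_sum)
  fix w assume "w \<in> Poly_Mapping.keys f"
  then have p: "sum_list (map (gen_parity s) w) = p"
    using assms by (simp add: homogeneous_def)
  have "prod_list (map (\<lambda>(i, j, r). fps_nth (T_ser s i j) r) w) \<in> homogeneous (gen_parity s) (sum_list (map (gen_parity s) w))"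
  proof (induction w)
    case Nil
    show ?case using homogeneous_closed(2)[of 1] by simp
  next
    case (Cons g w)
    obtain i j r where g: "g = (i, j, r)" by (cases g)
    show ?case
      using homogeneous_closed(5)[OF homogeneous_T_ser Cons] by (simp add: g gen_parity_def)
  qed
  from homogeneous_closed(5)[OF homogeneous_closed(2) this]
  show "scal (Poly_Mapping.lookup f w) * prod_list (map (\<lambda>(i, j, r). fps_nth (T_ser s i j) r) w)
      \<in> homogeneous (gen_parity s) p"
    unfolding p add_0_left .
qed

lemma free_yangian_grade: "grade (free_yangian s m n) p = carrier (free_yangian s m n) \<inter> homogeneous (gen_parity s) p"
  by (auto simp: free_yangian_def free_superalg_def homogeneous_def)

text \<open>The lift to the free algebra descends to the quotients; a homomorphism is unique since the
  generators determine it on the free algebra.\<close>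
theorem proposition4p3:
  fixes N :: nat and s :: "nat \<Rightarrow> int"
  assumes "N \<ge> 3"
    and "parity_sequence N s"
    and "symmetric_sequence N s"
  shows "\<exists>!\<phi>. \<phi> \<in> superalg_hom (ext_twisted_super_yangian s 2 (N - 1))
                               (ext_twisted_super_yangian s 1 N)
            \<and> \<phi> \<in> extensional (carrier (ext_twisted_super_yangian s 2 (N - 1)))
            \<and> (\<forall>i \<in> {2..N - 1}. \<forall>j \<in> {2..N - 1}. \<forall>r.
                 \<phi> (yangian_class s 2 (N - 1) (fps_nth (x_ser i j) r)) =
                 yangian_class s 1 N (fps_nth (T_ser s i j) r))"
proof -
  interpret H: unital_hom "T_lift s" by (rule T_lift_hom)
  let ?A = "ext_twisted_super_yangian s 2 (N - 1)" and ?B = "ext_twisted_super_yangian s 1 N"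
  let ?C = "carrier (free_yangian s 2 (N - 1))"
  let ?a = "yangian_class s 2 (N - 1)" and ?b = "yangian_class s 1 N"
  \<comment> \<open>The image of a coset is read off from an arbitrary representative.\<close>
  define \<phi> where "\<phi> = (\<lambda>X \<in> carrier ?A. ?b (T_lift s (SOME f. f \<in> X)))"
  have \<phi>: "\<phi> (?a f) = ?b (T_lift s f)" if f: "f \<in> ?C" for f
  proof -
    define g where "g = (SOME g. g \<in> ?a f)"
    have "g \<in> ?a f"
      unfolding g_def by (rule someI[of _ f]) (rule yangian_class_self)
    then have g: "g \<in> ?C" "?a g = ?a f"
      using yangian_class_mem[OF f] by auto
    then have "T_lift s (g - f) \<in> yangian_ideal s 1 N"
      using yangian_class_eq_iff[OF g(1) f] by (intro T_lift_ideal assms) simp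
    then have "?b (T_lift s g) = ?b (T_lift s f)"
      using f g(1) by (subst yangian_class_eq_iff) (simp_all add: T_lift_carrier H.hom_diff del: One_nat_def)
    then show ?thesis
      using f by (simp add: \<phi>_def g_def yangian_carrier)
  qed
  have x: "fps_nth (x_ser i j) r \<in> ?C" "T_lift s (fps_nth (x_ser i j) r) = fps_nth (T_ser s i j) r"
    if "i \<in> {2..N - 1}" "j \<in> {2..N - 1}" for i j r
    using x_ser_carrier[OF that] T_lift_x_ser[of i j s] that by (simp_all flip: map_fps_nth)
  show ?thesis
  proof (rule ex1I)
    have "\<phi> \<in> ring_hom ?A ?B"
      unfolding ring_hom_def
      by (auto simp: yangian_carrier yangian_simps \<phi> free_yangian_closed T_lift_carrier H.hom_add
          H.hom_mult H.hom_one yangian_one free_yangian_one simp del: One_nat_def)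
    moreover have "\<phi> (c \<odot>\<^bsub>?A\<^esub> X) = c \<odot>\<^bsub>?B\<^esub> \<phi> X" if "X \<in> carrier ?A" for c X
      using that by (auto simp: yangian_carrier yangian_smult \<phi> free_yangian_scal T_lift_carrier T_lift_scal
          simp del: One_nat_def)
    moreover have "\<phi> X \<in> grade ?B p" if "X \<in> grade ?A p" for X p
      using that by (auto simp: yangian_grade free_yangian_grade \<phi> T_lift_carrier T_lift_homogeneous simp del: One_nat_def)
    ultimately show "\<phi> \<in> superalg_hom ?A ?B \<and> \<phi> \<in> extensional (carrier ?A)
      \<and> (\<forall>i \<in> {2..N - 1}. \<forall>j \<in> {2..N - 1}. \<forall>r. \<phi> (?a (fps_nth (x_ser i j) r)) = ?b (fps_nth (T_ser s i j) r))"
      using x by (auto simp: superalg_hom_def \<phi> simp del: One_nat_def) (simp add: \<phi>_def)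
  next
    fix \<psi>
    assume \<psi>: "\<psi> \<in> superalg_hom ?A ?B \<and> \<psi> \<in> extensional (carrier ?A)
      \<and> (\<forall>i \<in> {2..N - 1}. \<forall>j \<in> {2..N - 1}. \<forall>r. \<psi> (?a (fps_nth (x_ser i j) r)) = ?b (fps_nth (T_ser s i j) r))"
    then have hom: "\<psi> \<in> ring_hom ?A ?B" and smult: "\<And>c X. X \<in> carrier ?A \<Longrightarrow> \<psi> (c \<odot>\<^bsub>?A\<^esub> X) = c \<odot>\<^bsub>?B\<^esub> \<psi> X"
      by (auto simp: superalg_hom_def)
    have C: "?a f \<in> carrier ?A" if "f \<in> ?C" for f
      using that by (simp add: yangian_carrier)
    have \<psi>_eq: "\<psi> (?a f) = ?b (T_lift s f)" if "f \<in> ?C" for f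
      using that unfolding free_yangian_def
    proof (induction rule: free_superalg_induct)
      case (scal c)
      note one = free_yangian_one[of s 2 "N - 1"] and one' = free_yangian_one[of s 1 N]
      have "\<psi> (?a (scal c * 1)) = c \<odot>\<^bsub>?B\<^esub> \<psi> (?a 1)"
        using smult[OF C[OF one], of c] unfolding yangian_smult[OF one] .
      also have "\<psi> (?a 1) = ?b 1"
        using ring_hom_one[OF hom] by (simp add: yangian_one)
      also have "c \<odot>\<^bsub>?B\<^esub> ?b 1 = ?b (T_lift s (scal c * 1))"
        by (simp add: yangian_smult one' T_lift_scal H.hom_one del: mult_1_right One_nat_def)
      finally show ?case by simp
    next
      case (gen g)
      then obtain i j r where g: "g = (i, j, r)" "i \<in> {2..N - 1}" "j \<in> {2..N - 1}" "r \<ge> 1"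
        by (auto simp: gens_def)
      then have "Poly_Mapping.single [g] 1 = fps_nth (x_ser i j) r"
        by (simp add: x_ser_def)
      then show ?case
        using \<psi> g x(2)[of i j r] by simp
    next
      case (add f g)
      then show ?case
        using ring_hom_add[OF hom C C, of f g]
        by (simp add: yangian_simps H.hom_add T_lift_carrier flip: free_yangian_def del: One_nat_def)
    next
      case (mult f g)
      then show ?case
        using ring_hom_mult[OF hom C C, of f g]
        by (simp add: yangian_simps H.hom_mult T_lift_carrier flip: free_yangian_def del: One_nat_def)
    qed
    show "\<psi> = \<phi>"
    proof (rule extensionalityI[of _ "carrier ?A"])
      show "\<psi> \<in> extensional (carrier ?A)" using \<psi> by blast
      show "\<phi> \<in> extensional (carrier ?A)" by (simp add: \<phi>_def)
      show "\<psi> X = \<phi> X" if "X \<in> carrier ?A" for X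
        using that by (auto simp: yangian_carrier \<psi>_eq \<phi> simp del: One_nat_def)
    qed
  qed
qed

end
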